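(* Consider the scalar networked control system, the steady-state Kalman filter and LQG gain, the watermarked control law $u_k=L\hat x_{k|k}+e_k$, and the attack model described in the context. Let $f_{\gamma_k,e_{k-1}}$ be the (steady-state) joint distribution of the true innovation $\gamma_k$ (no attack) and the watermarking signal $e_{k-1}$, and let $f_{\tilde\gamma_k,e_{k-1}}$ be the (steady-state) joint distribution of the false innovation $\tilde\gamma_k$ (under attack) and the watermarking signal $e_{k-1}$. Then the Kullback-Leibler divergence between these joint distributions is $$D\big(f_{\tilde\gamma_k,e_{k-1}}\,\|\,f_{\gamma_k,e_{k-1}}\big)=\frac12\log\Big(\frac{1}{1-\lambda^2}\Big)+\frac12\Big(\frac{\sigma_{\tilde\gamma}^2}{\sigma_\gamma^2}-1-\log\frac{\sigma_{\tilde\gamma}^2}{\sigma_\gamma^2}\Big),$$ where $$\lambda=\frac{-BC\sigma_e}{\sigma_{\tilde\gamma}},\qquad \sigma_\gamma^2=C^2P+R,$$ $$\sigma_{\tilde\gamma}^2=\left[\Big(1-\frac{\rho\, CK(A+BL)}{1-\rho\mathcal{A}}\Big)^2+\frac{(1-\rho^2)C^2K^2(A+BL)^2}{(1-\mathcal{A}^2)(1-\rho\mathcal{A})^2}\right]\sigma_z^2+\frac{B^2C^2}{1-\mathcal{A}^2}\,\sigma_e^2,$$ $$\mathcal{A}=(1-CK)(A+BL).$$ Here $\mathcal{A}<1$ (from stabilizability and detectability, which are automatic for the scalar case), and $|\lambda|<1$.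
   Context: All quantities are real scalars. System: $x_{k+1}=Ax_k+Bu_k+w_k$, $y_k=Cx_k+v_k$, where $w_k\sim\mathcal N(0,Q)$ is i.i.d. process noise and $v_k\sim\mathcal N(0,R)$ is i.i.d. measurement noise independent of the process noise. The system started at time $-\infty$ and is in steady state; stabilizability and detectability are taken to be guaranteed because the system is scalar. Steady-state Kalman filter: $\hat x_{k+1|k}=A\hat x_{k|k}+Bu_k$, $\hat x_{k|k}=\hat x_{k|k-1}+K\gamma_k$, with innovation $\gamma_k=y_k-C\hat x_{k|k-1}$ and gain $K=\frac{CP}{C^2P+R}$, where $P$ is the steady-state minimum mean-squared estimation error variance $E(x_k-\hat x_{k|k-1})^2$, obtained from $P=A^2P+Q-A^2C^2P^2(C^2P+R)^{-1}$. Here $\hat x_{k+1|k}$ and $\hat x_{k|k}$ are the conditional expectations of $x_{k+1}$ and $x_k$ given the measurements received up to time $k$. LQG gain: for positive weights $W,U$ (infinite-horizon average cost with stage cost $Wx_k^2+Uu_k^2$), $L=\frac{-ABS}{B^2S+U}$, where $S$ solves $S=A^2S+W-A^2B^2S^2(B^2S+U)^{-1}$. Watermarking: the controller applies $u_k=L\hat x_{k|k}+e_k$, where $(e_k)$ is an i.i.d. zero-mean Gaussian sequence with variance $\sigma_e^2$, known only to the controller, and independent of the process and measurement noises. Attack: from the time of the attack on, the controller receives $z_k$ instead of $y_k$ at every time, where $(z_k)$ is a stationary sequence injected by the attacker, independent of the watermarking signal, with $E(z_k^2)=\sigma_z^2$ and $E(z_kz_{k-k'})=\rho^{k'}\sigma_z^2$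 for lags $k'\ge 0$, with $\rho<1$. The controller, not knowing whether there is an attack, runs the same recursions on the received data: $\hat x^F_{k|k-1}=(A+BL)\hat x^F_{k-1|k-1}+Be_{k-1}$, $\tilde\gamma_k=z_k-C\hat x^F_{k|k-1}$, $\hat x^F_{k|k}=\hat x^F_{k|k-1}+K\tilde\gamma_k$. The quantities $\sigma_\gamma^2$ and $\sigma_{\tilde\gamma}^2$ are the steady-state variances of $\gamma_k$ and $\tilde\gamma_k$. The Kullback-Leibler divergence between densities is $D(f\|g)=\int f\log(f/g)$.
   Formalization: The injected sequence z is additionally assumed to be a Gaussian process; without this the formula fails (e.g. A=0, z i.i.d. uniform gives a larger divergence). The variances Q, R, σ_e², σ_z² are taken positive and S is taken as the nonnegative solution. *)

theory Defs
  imports "HOL-Probability.Probability"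
begin

text \<open>Random processes are indexed by the integers: a system started at time minus infinity and
  running in steady state is described by signals that satisfy the recursions at every integer
  time.\<close>

definition iid_gaussian :: "'a measure \<Rightarrow> (int \<Rightarrow> 'a \<Rightarrow> real) \<Rightarrow> real \<Rightarrow> bool" where
  "iid_gaussian M X s2 \<longleftrightarrow>
     prob_space.indep_vars M (\<lambda>_. borel) X UNIV \<and>
     (\<forall>k. distributed M lborel (X k) (normal_density 0 (sqrt s2)))"

text \<open>Mutual independence of whole processes, each viewed as a single random element of the
  space of trajectories.\<close>

definition indep_processes :: "'a measure \<Rightarrow> (int \<Rightarrow> 'a \<Rightarrow> real) list \<Rightarrow> bool" where
  "indep_processes M Xs \<longleftrightarrow>
     prob_space.indep_vars M (\<lambda>_. \<Pi>\<^sub>M k\<in>UNIV. borel) (\<lambda>n \<omega> k. (Xs ! n) k \<omega>) {..<length Xs}"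

text \<open>Strict stationarity: the law on trajectory space is invariant under time shifts.\<close>

definition stationary :: "'a measure \<Rightarrow> 'b measure \<Rightarrow> (int \<Rightarrow> 'a \<Rightarrow> 'b) \<Rightarrow> bool" where
  "stationary M N X \<longleftrightarrow>
     (\<forall>k. X k \<in> measurable M N) \<and>
     (\<forall>h. distr M (\<Pi>\<^sub>M k\<in>UNIV. N) (\<lambda>\<omega> k. X (k + h) \<omega>) =
          distr M (\<Pi>\<^sub>M k\<in>UNIV. N) (\<lambda>\<omega> k. X k \<omega>))"

text \<open>Gaussian process: every finite linear combination is Gaussian. The case of standard
  deviation zero is the degenerate Gaussian law, a point mass, which has no density. The mean is
  not prescribed.\<close>

definition gaussian_process :: "'a measure \<Rightarrow> (int \<Rightarrow> 'a \<Rightarrow> real) \<Rightarrow> bool" where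
  "gaussian_process M X \<longleftrightarrow>
     (\<forall>k. X k \<in> borel_measurable M) \<and>
     (\<forall>J c. finite J \<longrightarrow>
        (\<exists>m s. (s = 0 \<and> (AE \<omega> in M. (\<Sum>j\<in>J. c j * X j \<omega>) = m)) \<or>
               (s > 0 \<and> distributed M lborel (\<lambda>\<omega>. \<Sum>j\<in>J. c j * X j \<omega>) (normal_density m s))))"

text \<open>In \<open>KL_divergence b M N\<close> the reference law is the first measure argument, so that
  \<open>KL_divergence (exp 1) M N\<close> is the divergence of N from M, the mean under N of the natural
  logarithm of dN/dM. The following abbreviation restores the order of the usual notation
  D(f || g).\<close>

abbreviation KL :: "'b measure \<Rightarrow> 'b measure \<Rightarrow> real" where
  "KL f g \<equiv> KL_divergence (exp 1) g f"

end

theory Submission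
  imports Defs
begin

text \<open>Write \<open>E\<close> for the watermark sample \<open>e\<^sub>k\<^sub>-\<^sub>1\<close>. Without attack, the innovation is \<open>C\<close> times the
  prediction error plus measurement noise, and the prediction error obeys a recursion driven by the
  two noises only: the known input cancels. Hence the innovation is independent of \<open>E\<close>, centred
  normal, with variance \<open>C\<^sup>2 P + R\<close>. Under attack, \<open>E\<close> enters the predicted state with weight \<open>B\<close>
  and is not compensated by the received data, so the false innovation is \<open>V - B C E\<close> with \<open>V\<close>
  independent of \<open>E\<close>. If \<open>V\<close> is centred normal with positive variance, the two joint laws are
  bivariate normal with positive densities; the factor for \<open>E\<close> cancels in their ratio, whose
  logarithm is a constant plus a combination of two squares with known second moments
  (\<open>KL_shear_indep_normal\<close>). Since \<open>lam\<close> is the correlation coefficient of \<open>V - B C E\<close> and \<open>E\<close>, the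
  variance of \<open>V\<close> is \<open>(1 - lam\<^sup>2)\<close> times that of the false innovation, and the divergence takes the
  stated form.

  The work lies in the laws of the innovation and of \<open>V\<close>. Both come from a process \<open>X\<close> with
  \<open>X\<^sub>i\<^sub>+\<^sub>1 = a X\<^sub>i + input\<^sub>i\<close>, where \<open>\<bar>a\<bar> < 1\<close> is read off the Riccati equations
  (\<open>kalman_closed_loop\<close>, \<open>lqg_closed_loop\<close>). Unrolling \<open>n\<close> steps expresses the quantity of interest
  as a finite linear combination of Gaussian inputs plus a multiple of \<open>a\<^sup>n X\<^sub>k\<^sub>-\<^sub>n\<close>. The law of
  \<open>X\<^sub>k\<^sub>-\<^sub>n\<close> does not depend on \<open>n\<close>, so this remainder tends to zero in probability, whatever
  the tails of that law. To carry normality and independence of \<open>E\<close> through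
  this limit together, the argument follows characteristic functions restricted to the events
  \<open>E \<in> Y\<close> (\<open>normal_on\<close>): they converge (\<open>normal_on_limit\<close>), and if for all Borel sets \<open>Y\<close> they equal the
  normal characteristic function times the probability of \<open>E \<in> Y\<close>, Levy's uniqueness theorem gives
  both properties (\<open>distributed_normal_on\<close>, \<open>indep_var_normal_on\<close>).

  The variances are limits of explicit finite sums. The one for the injected sequence uses its
  geometric autocorrelation (\<open>prediction_residual_tendsto\<close>). Two facts about this sequence are
  implicit in the autocorrelation: its mean is zero (\<open>constant_mean_zero\<close>), and \<open>\<rho>\<close> is at least \<open>-1\<close>.
  The variance of \<open>V\<close> is positive because the closed-loop gains satisfy \<open>\<bar>A + B L\<bar> < 1\<close>, even in the
  case \<open>\<rho> = - 1\<close> of an alternating sequence (\<open>prediction_residual_pos\<close>).\<close>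

section \<open>Centred normal variables and restricted characteristic functions\<close>

text \<open>For \<open>D = space M\<close> this says that \<open>X\<close> is centred normal with variance \<open>v\<close>, where \<open>v = 0\<close>
  stands for a variable that vanishes almost surely. For an event \<open>D\<close> of positive probability it
  says the same under the conditional probability given \<open>D\<close>; multiplying by the measure of \<open>D\<close>
  instead of conditioning makes null events harmless.\<close>

definition normal_on :: "'a measure \<Rightarrow> 'a set \<Rightarrow> ('a \<Rightarrow> real) \<Rightarrow> real \<Rightarrow> bool" where
  "normal_on M D X v \<longleftrightarrow> X \<in> borel_measurable M \<and>
     (\<forall>t. (\<integral>\<omega>. indicator D \<omega> *\<^sub>R iexp (t * X \<omega>) \<partial>M) = of_real (exp (- v * t\<^sup>2 / 2) * measure M D))"

text \<open>The truncation at 1 is what makes the bound usable for variables without moments: its right-hand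
  side has a finite mean, which tends to zero under convergence in probability.\<close>

lemma cmod_iexp_diff_le:
  fixes x y t :: real
  shows "cmod (iexp (t * x) - iexp (t * y)) \<le> (2 + \<bar>t\<bar>) * min 1 \<bar>x - y\<bar>"
proof -
  have "iexp (t * x) - iexp (t * y) = iexp (t * y) * (iexp (t * (x - y)) - 1)"
    by (simp add: exp_add[symmetric] algebra_simps)
  then have eq: "cmod (iexp (t * x) - iexp (t * y)) = cmod (iexp (t * (x - y)) - 1)"
    by (simp add: norm_mult)
  have 1: "cmod (iexp (t * (x - y)) - 1) \<le> \<bar>t\<bar> * \<bar>x - y\<bar>"
    using iexp_approx1[of "t * (x - y)" 0] by (simp add: abs_mult)
  have 2: "cmod (iexp (t * (x - y)) - 1) \<le> 2"
    using norm_triangle_ineq4[of "iexp (t * (x - y))" 1] by simp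
  show ?thesis
  proof (cases "\<bar>x - y\<bar> \<le> 1")
    case True
    have "\<bar>t\<bar> * \<bar>x - y\<bar> \<le> (2 + \<bar>t\<bar>) * \<bar>x - y\<bar>" by (intro mult_right_mono) auto
    with 1 True show ?thesis unfolding eq by (simp only: min_absorb2)
  next
    case False
    then show ?thesis using 2 unfolding eq by simp
  qed
qed

context prob_space
begin

lemma integrable_indicator_iexp:
  assumes [measurable]: "D \<in> events" "X \<in> borel_measurable M"
  shows "integrable M (\<lambda>\<omega>. indicator D \<omega> *\<^sub>R iexp (t * X \<omega>))"
  by (rule integrable_const_bound[where B=1]) (auto simp: indicator_def)

text \<open>The last hypothesis is convergence in probability. It moves the restricted characteristic
  functions to their limit at every fixed argument.\<close>

lemma normal_on_limit:
  assumes D[measurable]: "D \<in> events"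
    and X: "\<And>n. normal_on M D (X n) (v n)"
    and Y[measurable]: "Y \<in> borel_measurable M"
    and v: "v \<longlonglongrightarrow> u"
    and conv: "(\<lambda>n. expectation (\<lambda>\<omega>. min 1 \<bar>X n \<omega> - Y \<omega>\<bar>)) \<longlonglongrightarrow> 0"
  shows "normal_on M D Y u"
  unfolding normal_on_def
proof (intro conjI allI Y)
  fix t :: real
  have [measurable]: "X n \<in> borel_measurable M" for n
    using X by (simp add: normal_on_def)
  let ?I = "\<lambda>Z. \<integral>\<omega>. indicator D \<omega> *\<^sub>R iexp (t * Z \<omega>) \<partial>M"
  have bound: "cmod (?I (X n) - ?I Y) \<le> (2 + \<bar>t\<bar>) * expectation (\<lambda>\<omega>. min 1 \<bar>X n \<omega> - Y \<omega>\<bar>)" for n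
  proof -
    have "?I (X n) - ?I Y
        = (\<integral>\<omega>. indicator D \<omega> *\<^sub>R iexp (t * X n \<omega>) - indicator D \<omega> *\<^sub>R iexp (t * Y \<omega>) \<partial>M)"
      by (rule Bochner_Integration.integral_diff[symmetric]; rule integrable_indicator_iexp) auto
    also have "cmod \<dots> \<le> (\<integral>\<omega>. (2 + \<bar>t\<bar>) * min 1 \<bar>X n \<omega> - Y \<omega>\<bar> \<partial>M)"
    proof (rule order_trans[OF integral_norm_bound integral_mono])
      show "integrable M (\<lambda>\<omega>. (2 + \<bar>t\<bar>) * min 1 \<bar>X n \<omega> - Y \<omega>\<bar>)"
        by (intro integrable_mult_right integrable_const_bound[where B=1]) auto
      show "integrable M (\<lambda>\<omega>. cmod (indicator D \<omega> *\<^sub>R iexp (t * X n \<omega>)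
          - indicator D \<omega> *\<^sub>R iexp (t * Y \<omega>)))"
        by (intro integrable_norm Bochner_Integration.integrable_diff integrable_indicator_iexp; simp)
      show "cmod (indicator D \<omega> *\<^sub>R iexp (t * X n \<omega>) - indicator D \<omega> *\<^sub>R iexp (t * Y \<omega>))
            \<le> (2 + \<bar>t\<bar>) * min 1 \<bar>X n \<omega> - Y \<omega>\<bar>" for \<omega>
        using cmod_iexp_diff_le[of t "X n \<omega>" "Y \<omega>"]
        by (cases "\<omega> \<in> D") auto
    qed
    finally show ?thesis by simp
  qed
  have "(\<lambda>n. (2 + \<bar>t\<bar>) * expectation (\<lambda>\<omega>. min 1 \<bar>X n \<omega> - Y \<omega>\<bar>)) \<longlonglongrightarrow> 0"
    using tendsto_mult_right_zero[OF conv] by simp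
  then have "(\<lambda>n. ?I (X n) - ?I Y) \<longlonglongrightarrow> 0"
    by (rule Lim_null_comparison[rotated]) (use bound in auto)
  then have lim1: "(\<lambda>n. ?I (X n)) \<longlonglongrightarrow> ?I Y"
    by (simp add: LIM_zero_iff)
  have lim2: "(\<lambda>n. complex_of_real (exp (- v n * t\<^sup>2 / 2) * measure M D))
      \<longlonglongrightarrow> of_real (exp (- u * t\<^sup>2 / 2) * measure M D)"
    by (intro tendsto_intros v) auto
  have "?I (X n) = of_real (exp (- v n * t\<^sup>2 / 2) * measure M D)" for n
    using X by (simp add: normal_on_def)
  then have lim3: "(\<lambda>n. ?I (X n)) \<longlonglongrightarrow> of_real (exp (- u * t\<^sup>2 / 2) * measure M D)"
    using lim2 by simp
  show "?I Y = of_real (exp (- u * t\<^sup>2 / 2) * measure M D)"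
    by (rule LIMSEQ_unique[OF lim1 lim3])
qed

lemma normal_on_zero: "D \<in> events \<Longrightarrow> normal_on M D (\<lambda>_. 0) 0"
  by (simp add: normal_on_def scaleR_conv_of_real)

lemma normal_on_scale:
  assumes "normal_on M D X v"
  shows "normal_on M D (\<lambda>\<omega>. c * X \<omega>) (c\<^sup>2 * v)"
  unfolding normal_on_def
proof (intro conjI allI)
  show "(\<lambda>\<omega>. c * X \<omega>) \<in> borel_measurable M"
    using assms by (auto simp: normal_on_def)
  fix t
  have "(\<integral>\<omega>. indicator D \<omega> *\<^sub>R iexp ((t * c) * X \<omega>) \<partial>M)
      = of_real (exp (- v * (t * c)\<^sup>2 / 2) * measure M D)"
    using assms unfolding normal_on_def by blast
  then show "(\<integral>\<omega>. indicator D \<omega> *\<^sub>R iexp (t * (c * X \<omega>)) \<partial>M)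
      = of_real (exp (- (c\<^sup>2 * v) * t\<^sup>2 / 2) * measure M D)"
    by (simp add: mult_ac power_mult_distrib)
qed

text \<open>The restricted characteristic function of the sum factors because \<open>D\<close> and \<open>Y\<close> are both
  determined by \<open>Z\<close>, whereas \<open>X\<close> is determined by \<open>W\<close>. In the applications \<open>W\<close> and \<open>Z\<close> are
  trajectories, or families of trajectories, of independent processes.\<close>

lemma normal_on_add:
  assumes X: "normal_on M (space M) X v"
    and Y: "normal_on M D Y u"
    and ind: "indep_var N' W N Z"
    and f: "f \<in> borel_measurable N'" "\<And>\<omega>. \<omega> \<in> space M \<Longrightarrow> X \<omega> = f (W \<omega>)"
    and g: "g \<in> borel_measurable N" "\<And>\<omega>. \<omega> \<in> space M \<Longrightarrow> Y \<omega> = g (Z \<omega>)"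
    and B: "B \<in> sets N" "D = Z -` B \<inter> space M"
  shows "normal_on M D (\<lambda>\<omega>. X \<omega> + Y \<omega>) (v + u)"
  unfolding normal_on_def
proof (intro conjI allI)
  have [measurable]: "X \<in> borel_measurable M" "Y \<in> borel_measurable M"
    using X Y by (auto simp: normal_on_def)
  show "(\<lambda>\<omega>. X \<omega> + Y \<omega>) \<in> borel_measurable M" by simp
  have Z: "Z \<in> measurable M N" using indep_var_rv2[OF ind] .
  have D[measurable]: "D \<in> events" using B Z by (auto intro: measurable_sets)
  fix t
  let ?a = "\<lambda>x. iexp (t * f x)"
  let ?b = "\<lambda>z. indicator B z *\<^sub>R iexp (t * g z)"
  have a: "?a \<in> borel_measurable N'" using f(1) by measurable
  have b: "?b \<in> borel_measurable N" using g(1) B(1) by measurable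
  have ind': "indep_var borel (?a \<circ> W) borel (?b \<circ> Z)"
    by (rule indep_var_compose[OF ind a b])
  have bZ: "(?b \<circ> Z) \<omega> = indicator D \<omega> *\<^sub>R iexp (t * Y \<omega>)" if "\<omega> \<in> space M" for \<omega>
    using that g(2)[OF that] by (auto simp: B(2) indicator_def)
  have aW: "(?a \<circ> W) \<omega> = iexp (t * X \<omega>)" if "\<omega> \<in> space M" for \<omega>
    using f(2)[OF that] by simp
  have int1: "integrable M (?a \<circ> W)"
    by (subst Bochner_Integration.integrable_cong[OF refl aW])
       (auto intro!: integrable_const_bound[where B=1])
  have int2: "integrable M (?b \<circ> Z)"
    using integrable_indicator_iexp[of D Y t]
    by (subst Bochner_Integration.integrable_cong[OF refl bZ]) auto
  have "(\<integral>\<omega>. indicator D \<omega> *\<^sub>R iexp (t * (X \<omega> + Y \<omega>)) \<partial>M) = (\<integral>\<omega>. (?a \<circ> W) \<omega> * (?b \<circ> Z) \<omega> \<partial>M)"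
  proof (rule Bochner_Integration.integral_cong[OF refl])
    fix \<omega> assume "\<omega> \<in> space M"
    from aW[OF this] bZ[OF this] show "indicator D \<omega> *\<^sub>R iexp (t * (X \<omega> + Y \<omega>)) = (?a \<circ> W) \<omega> * (?b \<circ> Z) \<omega>"
      by (simp add: exp_add[symmetric] algebra_simps)
  qed
  also have "\<dots> = (\<integral>\<omega>. (?a \<circ> W) \<omega> \<partial>M) * (\<integral>\<omega>. (?b \<circ> Z) \<omega> \<partial>M)"
    by (rule indep_var_lebesgue_integral[OF ind' int1 int2])
  also have "(\<integral>\<omega>. (?b \<circ> Z) \<omega> \<partial>M) = of_real (exp (- u * t\<^sup>2 / 2) * measure M D)"
    using Y by (subst Bochner_Integration.integral_cong[OF refl bZ]) (auto simp: normal_on_def)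
  also have "(\<integral>\<omega>. (?a \<circ> W) \<omega> \<partial>M) = (\<integral>\<omega>. indicator (space M) \<omega> *\<^sub>R iexp (t * X \<omega>) \<partial>M)"
    using aW by (intro Bochner_Integration.integral_cong refl) auto
  also have "\<dots> = of_real (exp (- v * t\<^sup>2 / 2) * measure M (space M))"
    using X unfolding normal_on_def by blast
  also have "of_real (exp (- v * t\<^sup>2 / 2) * measure M (space M)) * of_real (exp (- u * t\<^sup>2 / 2) * measure M D)
      = complex_of_real (exp (- v * t\<^sup>2 / 2) * exp (- u * t\<^sup>2 / 2) * measure M D)"
    by (simp add: prob_space)
  also have "exp (- v * t\<^sup>2 / 2) * exp (- u * t\<^sup>2 / 2) = exp (- (v + u) * t\<^sup>2 / 2)"
    by (simp add: exp_add[symmetric] field_simps)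
  finally show "(\<integral>\<omega>. indicator D \<omega> *\<^sub>R iexp (t * (X \<omega> + Y \<omega>)) \<partial>M)
      = of_real (exp (- (v + u) * t\<^sup>2 / 2) * measure M D)" .
qed

lemma normal_on_space_iff_char:
  assumes [measurable]: "X \<in> borel_measurable M"
  shows "normal_on M (space M) X v \<longleftrightarrow>
    (\<forall>t. char (distr M borel X) t = of_real (exp (- v * t\<^sup>2 / 2)))"
proof -
  have "(\<integral>\<omega>. indicator (space M) \<omega> *\<^sub>R iexp (t * X \<omega>) \<partial>M) = char (distr M borel X) t" for t
    unfolding char_def by (subst integral_distr) (auto intro!: Bochner_Integration.integral_cong)
  then show ?thesis by (simp add: normal_on_def prob_space)
qed

lemma char_normal:
  assumes s: "s > 0" and X: "distributed M lborel X (normal_density 0 s)"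
  shows "char (distr M borel X) t = of_real (exp (- s\<^sup>2 * t\<^sup>2 / 2))"
proof -
  have [measurable]: "X \<in> borel_measurable M" using distributed_measurable[OF X] by simp
  have "distributed M lborel (\<lambda>x. X x / s) std_normal_density"
    using normal_standard_normal_convert[OF s, of X 0] X by simp
  then have "distr M lborel (\<lambda>x. X x / s) = std_normal_distribution"
    by (simp add: distributed_def)
  also have "distr M lborel (\<lambda>x. X x / s) = distr M borel (\<lambda>x. X x / s)"
    by (rule distr_cong) auto
  finally have "char (distr M borel (\<lambda>x. X x / s)) (t * s) = of_real (exp (- (t * s)\<^sup>2 / 2))"
    by (simp add: char_std_normal_distribution)
  moreover have "char (distr M borel (\<lambda>x. X x / s)) (t * s) = char (distr M borel X) t"
    using s unfolding char_def by (simp add: integral_distr)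
  ultimately show ?thesis by (simp add: power_mult_distrib mult_ac)
qed

lemma normal_on_distributed:
  assumes "s > 0" "distributed M lborel X (normal_density 0 s)"
  shows "normal_on M (space M) X (s\<^sup>2)"
  using char_normal[OF assms] distributed_measurable[OF assms(2)]
  by (subst normal_on_space_iff_char) auto

lemma real_distribution_normal: "s > 0 \<Longrightarrow> real_distribution (density lborel (normal_density 0 s))"
  by (simp add: real_distribution_def real_distribution_axioms_def prob_space_normal_density)

text \<open>Transfers the previous lemma to the law itself by taking the identity on the real line as the
  random variable.\<close>

lemma char_normal_density:
  assumes s: "s > 0"
  shows "char (density lborel (normal_density 0 s)) t = of_real (exp (- s\<^sup>2 * t\<^sup>2 / 2))"
proof -
  let ?N = "density lborel (normal_density 0 s)"
  interpret N: prob_space ?N by (rule prob_space_normal_density[OF s])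
  have 1: "distr ?N lborel (\<lambda>x. x) = ?N" by (rule distr_id2) simp
  have 2: "distr ?N borel (\<lambda>x. x) = ?N" by (rule distr_id2) simp
  have "distributed ?N lborel (\<lambda>x. x) (normal_density 0 s)"
    unfolding distributed_def 1 by simp
  from N.char_normal[OF s this, of t] show ?thesis by (simp only: 2)
qed

lemma distributed_normal_on:
  assumes X: "normal_on M (space M) X v" and v: "v > 0"
  shows "distributed M lborel X (normal_density 0 (sqrt v))"
proof -
  have [measurable]: "X \<in> borel_measurable M" using X by (simp add: normal_on_def)
  have "distr M borel X = density lborel (normal_density 0 (sqrt v))"
    using X v by (intro Levy_uniqueness real_distribution_normal real_distribution_distr)
       (auto simp: normal_on_space_iff_char char_normal_density)
  moreover have "distr M lborel X = distr M borel X"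
    by (rule distr_cong) auto
  ultimately show ?thesis
    by (auto simp: distributed_def)
qed

text \<open>Given an event \<open>E \<in> B\<close> of positive probability, the conditional law of \<open>X\<close> has the normal
  characteristic function, hence is the same normal law for every such \<open>B\<close>. This is independence.\<close>

lemma indep_var_normal_on:
  assumes X: "\<And>B. B \<in> sets N \<Longrightarrow> normal_on M (E -` B \<inter> space M) X v" and v: "v > 0"
    and E[measurable]: "E \<in> measurable M N"
  shows "indep_var borel X N E"
proof -
  let ?N = "density lborel (normal_density 0 (sqrt v))"
  have [measurable]: "X \<in> borel_measurable M"
    using X[of "space N"] by (simp add: normal_on_def)
  have cond: "prob (X -` A \<inter> space M \<inter> (E -` B \<inter> space M)) = measure ?N A * prob (E -` B \<inter> space M)"
    if A[measurable]: "A \<in> sets borel" and B: "B \<in> sets N" for A B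
  proof (cases "prob (E -` B \<inter> space M) = 0")
    case True
    have "prob (X -` A \<inter> space M \<inter> (E -` B \<inter> space M)) \<le> prob (E -` B \<inter> space M)"
      using B E by (intro finite_measure_mono) (auto intro: measurable_sets)
    with True show ?thesis by (metis measure_le_0_iff mult_zero_right)
  next
    case False
    define D where "D = E -` B \<inter> space M"
    have D[measurable]: "D \<in> events" using B E by (auto simp: D_def intro: measurable_sets)
    have pD: "prob D > 0" using False by (simp add: D_def zero_less_measure_iff)
    have eD: "emeasure M D \<noteq> 0" "emeasure M D \<noteq> \<infinity>"
      using pD by (auto simp: emeasure_eq_measure)
    let ?U = "uniform_measure M D"
    interpret U: prob_space ?U by (rule prob_space_uniform_measure[OF eD])
    have mU: "X \<in> borel_measurable ?U" by simp
    have Ud: "?U = density M (\<lambda>\<omega>. ennreal (indicator D \<omega> / prob D))"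
      unfolding uniform_measure_def
      by (rule density_cong) (use pD in \<open>auto simp: emeasure_eq_measure divide_ennreal[symmetric] split: split_indicator\<close>)
    have "distr ?U borel X = ?N"
    proof (rule Levy_uniqueness)
      show "real_distribution (distr ?U borel X)" by (rule U.real_distribution_distr[OF mU])
      show "real_distribution ?N" using v by (simp add: real_distribution_normal)
      show "char (distr ?U borel X) = char ?N"
      proof
        fix t
        have "char (distr ?U borel X) t = (\<integral>\<omega>. iexp (t * X \<omega>) \<partial>?U)"
          unfolding char_def by (subst integral_distr) auto
        also have "\<dots> = (\<integral>\<omega>. (indicator D \<omega> / prob D) *\<^sub>R iexp (t * X \<omega>) \<partial>M)"
          unfolding Ud by (subst integral_density) auto
        also have "\<dots> = (\<integral>\<omega>. (1 / prob D) *\<^sub>R (indicator D \<omega> *\<^sub>R iexp (t * X \<omega>)) \<partial>M)"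
          by simp
        also have "\<dots> = (1 / prob D) *\<^sub>R (\<integral>\<omega>. indicator D \<omega> *\<^sub>R iexp (t * X \<omega>) \<partial>M)"
          by (rule integral_scaleR_right) 
        also have "(\<integral>\<omega>. indicator D \<omega> *\<^sub>R iexp (t * X \<omega>) \<partial>M) = of_real (exp (- v * t\<^sup>2 / 2) * prob D)"
          using X[OF B] unfolding normal_on_def D_def by blast
        finally show "char (distr ?U borel X) t = char ?N t"
          using pD v by (simp add: char_normal_density scaleR_conv_of_real)
      qed
    qed
    then have "measure ?N A = measure (distr ?U borel X) A" by simp
    also have "\<dots> = measure ?U (X -` A \<inter> space M)"
      by (subst measure_distr[OF mU]) auto
    also have "\<dots> = prob (D \<inter> (X -` A \<inter> space M)) / prob D"
      using eD by (subst measure_uniform_measure) auto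
    finally show ?thesis using pD by (simp add: D_def Int_commute)
  qed
  \<comment> \<open>The event that \<open>E\<close> lies in the whole space identifies the unconditional law.\<close>
  have full: "prob (X -` A \<inter> space M) = measure ?N A" if "A \<in> sets borel" for A
  proof -
    have "E -` space N \<inter> space M = space M" using measurable_space[OF E] by auto
    then show ?thesis using cond[OF that sets.top] by (simp add: prob_space Int_absorb2)
  qed
  have eqX: "sigma_sets (space M) {X -` A \<inter> space M |A. A \<in> sets borel} = {X -` A \<inter> space M |A. A \<in> sets borel}"
    using sigma_sets_vimage_commute[of X "space M" "space borel" "sets borel"]
    unfolding sets.sigma_sets_eq by simp
  have eqE: "sigma_sets (space M) {E -` A \<inter> space M |A. A \<in> sets N} = {E -` A \<inter> space M |A. A \<in> sets N}"
    using sigma_sets_vimage_commute[of E "space M" "space N" "sets N"] measurable_space[OF E]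
    unfolding sets.sigma_sets_eq by auto
  show ?thesis
    unfolding indep_var_eq eqX eqE
  proof (intro conjI indep_setI)
    fix a b assume "a \<in> {X -` A \<inter> space M |A. A \<in> sets borel}" "b \<in> {E -` A \<inter> space M |A. A \<in> sets N}"
    then show "prob (a \<inter> b) = prob a * prob b"
      using cond full by auto
  qed (use E in \<open>auto intro: measurable_sets\<close>)
qed

end

section \<open>Divergence between sheared normal laws\<close>

text \<open>For fixed second coordinate the shear is a translation, and Lebesgue measure is translation
  invariant.\<close>

lemma distr_shear_lborel:
  fixes c :: real
  shows "distr (lborel \<Otimes>\<^sub>M lborel) (lborel \<Otimes>\<^sub>M lborel) (\<lambda>p. (fst p + c * snd p, snd p))
       = (lborel \<Otimes>\<^sub>M lborel :: (real \<times> real) measure)" (is "distr ?L ?L ?s = ?L")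
proof (rule measure_eqI)
  fix A assume "A \<in> sets (distr ?L ?L ?s)"
  then have A[measurable]: "A \<in> sets ?L" by simp
  have s[measurable]: "?s \<in> measurable ?L ?L" by (intro measurable_Pair) simp_all
  have "emeasure (distr ?L ?L ?s) A = (\<integral>\<^sup>+p. indicator A p \<partial>distr ?L ?L ?s)"
    by (subst nn_integral_indicator) (use A in simp_all)
  also have "\<dots> = (\<integral>\<^sup>+p. indicator A (?s p) \<partial>?L)"
    by (rule nn_integral_distr[OF s]) simp
  also have "\<dots> = (\<integral>\<^sup>+y. \<integral>\<^sup>+x. indicator A (x + c * y, y) \<partial>lborel \<partial>lborel)"
    by (subst lborel_pair.nn_integral_snd[symmetric]) auto
  also have "\<dots> = (\<integral>\<^sup>+y. \<integral>\<^sup>+x. indicator A (x, y) \<partial>lborel \<partial>lborel)"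
  proof (rule nn_integral_cong)
    fix y :: real
    have "(\<lambda>x. indicator A (x, y)) \<in> borel_measurable (borel :: real measure)" by measurable
    from nn_integral_real_affine[OF this, of 1 "c * y"]
    show "(\<integral>\<^sup>+x. indicator A (x + c * y, y) \<partial>lborel) = (\<integral>\<^sup>+x. indicator A (x, y) \<partial>lborel)"
      by (simp add: add.commute)
  qed
  also have "\<dots> = (\<integral>\<^sup>+p. indicator A p \<partial>?L)"
    by (subst lborel_pair.nn_integral_snd[symmetric]) auto
  also have "\<dots> = emeasure ?L A" by (rule nn_integral_indicator[OF A])
  finally show "emeasure (distr ?L ?L ?s) A = emeasure ?L A" .
qed simp

context prob_space
begin

lemma distr_shear_indep_normal:
  assumes V: "distributed M lborel V (normal_density 0 s)" and E: "distributed M lborel E (normal_density 0 r)"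
    and ind: "indep_var borel V borel E"
  shows "distr M borel (\<lambda>\<omega>. (V \<omega> + c * E \<omega>, E \<omega>))
    = density lborel (\<lambda>p. ennreal (normal_density 0 s (fst p - c * snd p) * normal_density 0 r (snd p)))"
proof -
  let ?L = "lborel \<Otimes>\<^sub>M lborel :: (real \<times> real) measure"
  let ?f = "\<lambda>p. ennreal (normal_density 0 s (fst p - c * snd p) * normal_density 0 r (snd p))"
  have [measurable]: "V \<in> borel_measurable M" "E \<in> borel_measurable M"
    using V E distributed_measurable by force+
  have "distributed M ?L (\<lambda>\<omega>. (V \<omega>, E \<omega>))
     (\<lambda>(x, y). ennreal (normal_density 0 s x) * ennreal (normal_density 0 r y))"
  proof (rule distributed_joint_indep[OF _ _ V E])
    show "indep_var lborel V lborel E" using ind by (simp add: indep_var_eq)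
  qed (simp_all add: lborel.sigma_finite_measure_axioms)
  then have D: "distr M ?L (\<lambda>\<omega>. (V \<omega>, E \<omega>))
     = density ?L (\<lambda>p. ennreal (normal_density 0 s (fst p) * normal_density 0 r (snd p)))"
    by (simp add: distributed_def case_prod_beta' ennreal_mult)
  have "distr M borel (\<lambda>\<omega>. (V \<omega> + c * E \<omega>, E \<omega>)) = distr M ?L (\<lambda>\<omega>. (V \<omega> + c * E \<omega>, E \<omega>))"
    by (rule distr_cong) (simp_all only: lborel_prod sets_lborel)
  also have "\<dots> = distr (distr M ?L (\<lambda>\<omega>. (V \<omega>, E \<omega>))) ?L (\<lambda>p. (fst p + c * snd p, snd p))"
    by (subst distr_distr) (auto simp: o_def)
  also have "\<dots> = distr (density ?L (\<lambda>p. ?f ((\<lambda>p. (fst p + c * snd p, snd p)) p))) ?L (\<lambda>p. (fst p + c * snd p, snd p))"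
    unfolding D by (simp add: case_prod_beta')
  also have "\<dots> = density (distr ?L ?L (\<lambda>p. (fst p + c * snd p, snd p))) ?f"
    by (rule density_distr[symmetric]) auto
  also have "\<dots> = density lborel ?f"
    unfolding distr_shear_lborel by (simp add: lborel_prod)
  finally show ?thesis .
qed

lemma normal_second_moment:
  assumes "s > 0" "distributed M lborel X (normal_density 0 s)"
  shows "integrable M (\<lambda>\<omega>. (X \<omega>)\<^sup>2)" "expectation (\<lambda>\<omega>. (X \<omega>)\<^sup>2) = s\<^sup>2"
proof -
  show "integrable M (\<lambda>\<omega>. (X \<omega>)\<^sup>2)"
    using integrable_normal_moment[OF assms(1), of 0 2] 
    by (subst distributed_integrable[OF assms(2), symmetric]) auto
  show "expectation (\<lambda>\<omega>. (X \<omega>)\<^sup>2) = s\<^sup>2"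
    using normal_distributed_variance[OF assms] normal_distributed_expectation[OF assms] by simp
qed

text \<open>The marginal density of \<open>E\<close> is common to both laws and cancels. In the coordinates \<open>(V, E)\<close> the
  log-likelihood ratio is \<open>ln (g / s) - V\<^sup>2 / (2 s\<^sup>2) + (V + c E)\<^sup>2 / (2 g\<^sup>2)\<close>, whose mean only involves
  the variances \<open>s\<^sup>2\<close> and \<open>h\<^sup>2\<close>.\<close>

lemma KL_shear_indep_normal:
  assumes pos: "s > 0" "r > 0" "g > 0" "h > 0"
    and V: "distributed M lborel V (normal_density 0 s)"
    and E: "distributed M lborel E (normal_density 0 r)"
    and G: "distributed M lborel G (normal_density 0 g)"
    and VE: "indep_var borel V borel E" and GE: "indep_var borel G borel E"
    and F: "distributed M lborel (\<lambda>\<omega>. V \<omega> + c * E \<omega>) (normal_density 0 h)"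
  shows "KL (distr M borel (\<lambda>\<omega>. (V \<omega> + c * E \<omega>, E \<omega>))) (distr M borel (\<lambda>\<omega>. (G \<omega>, E \<omega>)))
    = ln (g / s) - 1 / 2 + h\<^sup>2 / (2 * g\<^sup>2)"
proof -
  define q where "q = (\<lambda>p::real \<times> real. normal_density 0 s (fst p - c * snd p) * normal_density 0 r (snd p))"
  define d where "d = (\<lambda>p::real \<times> real. normal_density 0 g (fst p) * normal_density 0 r (snd p))"
  have [measurable]: "q \<in> borel_measurable borel" "d \<in> borel_measurable borel"
    unfolding q_def d_def by (simp_all add: borel_prod[symmetric])
  have q0: "q p > 0" and d0: "d p > 0" for p
    using pos by (simp_all add: q_def d_def normal_density_pos)
  have Q: "distr M borel (\<lambda>\<omega>. (V \<omega> + c * E \<omega>, E \<omega>)) = density lborel q"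
    using distr_shear_indep_normal[OF V E VE, of c] by (simp add: q_def)
  have D: "distr M borel (\<lambda>\<omega>. (G \<omega>, E \<omega>)) = density lborel d"
    using distr_shear_indep_normal[OF G E GE, of 0] by (simp add: d_def)
  have mF: "(\<lambda>\<omega>. (V \<omega> + c * E \<omega>, E \<omega>)) \<in> measurable M borel"
    using distributed_measurable[OF V] distributed_measurable[OF E] by (simp add: borel_prod[symmetric])
  have ratio: "log (exp 1) (q p / d p)
      = ln (g / s) - (fst p - c * snd p)\<^sup>2 / (2 * s\<^sup>2) + (fst p)\<^sup>2 / (2 * g\<^sup>2)" for p
  proof -
    have nd: "normal_density 0 u x = exp (- (x\<^sup>2 / (2 * u\<^sup>2))) / (sqrt (2 * pi) * u)" if "u > 0" for u x
      using that by (simp add: normal_density_def real_sqrt_mult)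
    have "q p / d p = normal_density 0 s (fst p - c * snd p) / normal_density 0 g (fst p)"
      using normal_density_pos[OF pos(2), of 0 "snd p"] by (simp add: q_def d_def)
    also have "\<dots> = (g / s) * (exp (- ((fst p - c * snd p)\<^sup>2 / (2 * s\<^sup>2))) / exp (- ((fst p)\<^sup>2 / (2 * g\<^sup>2))))"
      using pos by (simp add: nd)
    also have "\<dots> = (g / s) * exp (- (fst p - c * snd p)\<^sup>2 / (2 * s\<^sup>2) + (fst p)\<^sup>2 / (2 * g\<^sup>2))"
      unfolding exp_diff[symmetric] by simp
    finally have "q p / d p = (g / s) * exp (- (fst p - c * snd p)\<^sup>2 / (2 * s\<^sup>2) + (fst p)\<^sup>2 / (2 * g\<^sup>2))" .
    then show ?thesis using pos by (simp add: log_def ln_mult ln_div)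
  qed
  have "KL (density lborel q) (density lborel d) = (\<integral>p. q p * log (exp 1) (q p / d p) \<partial>lborel)"
  proof (rule sigma_finite_measure.KL_density_density)
    show "AE p in lborel. d p = 0 \<longrightarrow> q p = 0" by (intro AE_I2) (metis d0 less_irrefl)
  qed (use q0 d0 in \<open>auto simp: less_imp_le lborel.sigma_finite_measure_axioms\<close>)
  also have "\<dots> = (\<integral>p. log (exp 1) (q p / d p) \<partial>density lborel q)"
    using q0 by (subst integral_density) (auto simp: less_imp_le)
  also have "\<dots> = expectation (\<lambda>\<omega>. log (exp 1) (q (V \<omega> + c * E \<omega>, E \<omega>) / d (V \<omega> + c * E \<omega>, E \<omega>)))"
    unfolding Q[symmetric] by (subst integral_distr[OF mF]) auto
  also have "\<dots> = expectation (\<lambda>\<omega>. ln (g / s) - (V \<omega>)\<^sup>2 / (2 * s\<^sup>2) + (V \<omega> + c * E \<omega>)\<^sup>2 / (2 * g\<^sup>2))"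
    unfolding ratio by simp
  also have "\<dots> = ln (g / s) - s\<^sup>2 / (2 * s\<^sup>2) + h\<^sup>2 / (2 * g\<^sup>2)"
    using normal_second_moment[OF pos(1) V] normal_second_moment[OF pos(4) F] by (simp add: prob_space)
  finally show ?thesis using pos by (simp add: Q D)
qed

end

section \<open>Stationary, Gaussian and independent processes\<close>

text \<open>The error with respect to the fixed point contracts by \<open>b\<close> in each step, up to a perturbation
  that becomes arbitrarily small.\<close>

lemma affine_recursion_tendsto:
  fixes p r :: "nat \<Rightarrow> real"
  assumes rec: "\<And>n. p (Suc n) = b * p n + r n" and b: "\<bar>b\<bar> < 1" and r: "r \<longlonglongrightarrow> l"
  shows "p \<longlonglongrightarrow> l / (1 - b)"
proof -
  define d where "d n = p n - l / (1 - b)" for n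
  have d_Suc: "d (Suc n) = b * d n + (r n - l)" for n
    using b by (simp add: d_def rec field_simps)
  have "d \<longlonglongrightarrow> 0"
  proof (rule LIMSEQ_I)
    fix e :: real assume e: "e > 0"
    define q where "q = e * (1 - \<bar>b\<bar>) / 2"
    have "q > 0" using e b by (simp add: q_def)
    from LIMSEQ_D[OF r this] obtain N where N: "\<And>n. n \<ge> N \<Longrightarrow> \<bar>r n - l\<bar> < q" by auto
    \<comment> \<open>From \<open>N\<close> on, each step adds at most \<open>q\<close>, and \<open>q / (1 - \<bar>b\<bar>) = e / 2\<close>.\<close>
    have bd: "\<bar>d (N + m)\<bar> \<le> \<bar>b\<bar> ^ m * \<bar>d N\<bar> + e / 2" for m
    proof (induction m)
      case 0 then show ?case using e by simp
    next
      case (Suc m)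
      have "\<bar>d (N + Suc m)\<bar> \<le> \<bar>b\<bar> * \<bar>d (N + m)\<bar> + q"
        using N[of "N + m"] abs_triangle_ineq[of "b * d (N + m)" "r (N + m) - l"] by (simp add: d_Suc abs_mult)
      also have "\<dots> \<le> \<bar>b\<bar> * (\<bar>b\<bar> ^ m * \<bar>d N\<bar> + e / 2) + q"
        using Suc by (intro add_right_mono mult_left_mono) auto
      also have "\<dots> = \<bar>b\<bar> ^ Suc m * \<bar>d N\<bar> + e / 2" by (simp add: q_def field_simps)
      finally show ?case .
    qed
    have "(\<lambda>m. \<bar>b\<bar> ^ m * \<bar>d N\<bar>) \<longlonglongrightarrow> 0"
      using b by (intro tendsto_mult_left_zero LIMSEQ_power_zero) simp
    from LIMSEQ_D[OF this, of "e / 2"] e obtain m0 where m0: "\<And>m. m \<ge> m0 \<Longrightarrow> \<bar>b\<bar> ^ m * \<bar>d N\<bar> < e / 2"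
      by (auto simp: abs_mult)
    show "\<exists>no. \<forall>n\<ge>no. norm (d n - 0) < e"
    proof (intro exI[of _ "N + m0"] allI impI)
      fix n assume "n \<ge> N + m0"
      then obtain m where "n = N + m" "m \<ge> m0" by (metis add_le_cancel_left le_iff_add le_trans)
      then show "norm (d n - 0) < e" using bd[of m] m0[of m] by simp
    qed
  qed
  then have "(\<lambda>n. d n + l / (1 - b)) \<longlonglongrightarrow> 0 + l / (1 - b)" by (intro tendsto_intros)
  then show ?thesis by (simp add: d_def)
qed

lemma linear_recursion_backward:
  fixes Y X :: "int \<Rightarrow> real"
  assumes "\<And>i. Y (i + 1) = a * Y i + X i"
  shows "Y l = (\<Sum>j<n. a ^ j * X (l - 1 - int j)) + a ^ n * Y (l - int n)"
proof (induction n)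
  case (Suc n)
  have "Y (l - int n) = a * Y (l - int (Suc n)) + X (l - 1 - int n)"
    using assms[of "l - int (Suc n)"] by (simp add: algebra_simps)
  with Suc show ?case by (simp add: algebra_simps)
qed simp

context prob_space
begin

text \<open>Because all \<open>Y i\<close> have the same law, the expectation can be computed with \<open>Y 0\<close>, where dominated
  convergence applies. This discards the remote past of a stable recursion without any moment bound.\<close>

lemma rescaled_stationary_tendsto_zero:
  fixes Y :: "int \<Rightarrow> 'a \<Rightarrow> real"
  assumes [measurable]: "\<And>i. Y i \<in> borel_measurable M"
    and law: "\<And>i. distr M borel (Y i) = distr M borel (Y 0)"
    and b: "b \<longlonglongrightarrow> 0"
  shows "(\<lambda>n. expectation (\<lambda>\<omega>. min 1 \<bar>b n * Y (k n) \<omega>\<bar>)) \<longlonglongrightarrow> 0"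
proof -
  have "expectation (\<lambda>\<omega>. min 1 \<bar>b n * Y (k n) \<omega>\<bar>) = expectation (\<lambda>\<omega>. min 1 \<bar>b n * Y 0 \<omega>\<bar>)" for n
  proof -
    have "expectation (\<lambda>\<omega>. min 1 \<bar>b n * Y i \<omega>\<bar>) = (\<integral>y. min 1 \<bar>b n * y\<bar> \<partial>distr M borel (Y i))" for i
      by (subst integral_distr) auto
    then show ?thesis using law[of "k n"] by simp
  qed
  moreover have "(\<lambda>n. expectation (\<lambda>\<omega>. min 1 \<bar>b n * Y 0 \<omega>\<bar>)) \<longlonglongrightarrow> expectation (\<lambda>\<omega>. 0)"
  proof (rule integral_dominated_convergence[where w="\<lambda>_. 1"])
    show "AE \<omega> in M. (\<lambda>n. min 1 \<bar>b n * Y 0 \<omega>\<bar>) \<longlonglongrightarrow> 0"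
    proof (rule AE_I2)
      fix \<omega>
      have "(\<lambda>n. min 1 \<bar>b n * Y 0 \<omega>\<bar>) \<longlonglongrightarrow> min 1 \<bar>0 * Y 0 \<omega>\<bar>"
        by (intro tendsto_intros b)
      then show "(\<lambda>n. min 1 \<bar>b n * Y 0 \<omega>\<bar>) \<longlonglongrightarrow> 0" by simp
    qed
  qed auto
  ultimately show ?thesis by simp
qed

lemma stationary_marginal:
  assumes "stationary M N X"
  shows "distr M N (X i) = distr M N (X 0)"
proof -
  let ?T = "\<Pi>\<^sub>M k\<in>(UNIV::int set). N"
  have X: "X k \<in> measurable M N" for k using assms by (simp add: stationary_def)
  have ev: "(\<lambda>f. f 0) \<in> measurable ?T N" by simp
  have shift: "(\<lambda>\<omega> k. X (k + h) \<omega>) \<in> measurable M ?T" for h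
    using X by (intro measurable_PiM_single') (auto dest: measurable_space)
  have "distr M N (X h) = distr (distr M ?T (\<lambda>\<omega> k. X (k + h) \<omega>)) N (\<lambda>f. f 0)" for h
    by (subst distr_distr[OF ev shift]) (simp add: o_def)
  moreover have "distr M ?T (\<lambda>\<omega> k. X (k + i) \<omega>) = distr M ?T (\<lambda>\<omega> k. X (k + 0) \<omega>)"
    using assms by (simp add: stationary_def)
  ultimately show ?thesis by metis
qed

lemma iid_gaussianD:
  assumes "iid_gaussian M X s2"
  shows "indep_vars (\<lambda>_. borel) X UNIV" "X i \<in> borel_measurable M"
    "distributed M lborel (X i) (normal_density 0 (sqrt s2))"
  using assms distributed_measurable[of M lborel "X i"]
  by (auto simp: iid_gaussian_def)

text \<open>Induction over the index set, splitting off one term at a time: the index \<open>i\<close> stays on the side of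
  the remaining terms, so that its event remains available throughout.\<close>

lemma normal_on_iid_sum:
  assumes X: "iid_gaussian M X s2" and s2: "s2 > 0" and J: "finite J" "i \<notin> J" and B: "B \<in> sets borel"
  shows "normal_on M (X i -` B \<inter> space M) (\<lambda>\<omega>. \<Sum>j\<in>J. c j * X j \<omega>) (s2 * (\<Sum>j\<in>J. (c j)\<^sup>2))"
  using J
proof (induction J rule: finite_induct)
  case empty
  have "X i -` B \<inter> space M \<in> events" using iid_gaussianD(2)[OF X] B by (auto intro: measurable_sets)
  then show ?case by (simp add: normal_on_zero)
next
  case (insert j J)
  let ?R = "\<lambda>A. PiM A (\<lambda>_. borel :: real measure)" and ?r = "\<lambda>A \<omega>. restrict (\<lambda>i. X i \<omega>) A"
  let ?A = "insert i J"
  have ind: "indep_var (?R {j}) (?r {j}) (?R ?A) (?r ?A)"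
    by (rule indep_var_restrict[OF iid_gaussianD(1)[OF X]]) (use insert in auto)
  have "normal_on M (space M) (X j) s2"
    using normal_on_distributed[OF _ iid_gaussianD(3)[OF X]] s2 by simp
  then have Xj: "normal_on M (space M) (\<lambda>\<omega>. c j * X j \<omega>) ((c j)\<^sup>2 * s2)"
    by (rule normal_on_scale)
  have B': "{f \<in> space (?R ?A). f i \<in> B} \<in> sets (?R ?A)"
    using B by measurable
  have "normal_on M (X i -` B \<inter> space M) (\<lambda>\<omega>. c j * X j \<omega> + (\<Sum>j\<in>J. c j * X j \<omega>)) ((c j)\<^sup>2 * s2 + s2 * (\<Sum>j\<in>J. (c j)\<^sup>2))"
  proof (rule normal_on_add[OF Xj _ ind _ _ _ _ B'])
    show "(\<lambda>f. c j * f j) \<in> borel_measurable (?R {j})" by measurable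
    show "(\<lambda>f. \<Sum>j\<in>J. c j * f j) \<in> borel_measurable (?R ?A)" by measurable
    show "X i -` B \<inter> space M = (?r ?A) -` {f \<in> space (?R ?A). f i \<in> B} \<inter> space M"
      by (auto simp: space_PiM)
  qed (use insert in auto)
  then show ?case using insert by (simp add: algebra_simps)
qed

lemma normal_on_iid_past:
  assumes X: "iid_gaussian M X s2" "s2 > 0" and "l < i" and B: "B \<in> sets borel"
  shows "normal_on M (X i -` B \<inter> space M) (\<lambda>\<omega>. \<Sum>j<n. d j * X (l - int j) \<omega>) (s2 * (\<Sum>j<n. (d j)\<^sup>2))"
proof -
  let ?J = "(\<lambda>j. l - int j) ` {..<n}"
  have inj: "inj_on (\<lambda>j. l - int j) {..<n}" by (simp add: inj_on_def)
  have "i \<notin> ?J" using assms(3) by auto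
  from normal_on_iid_sum[OF X _ this B, of "\<lambda>i. d (nat (l - i))"]
  show ?thesis by (simp add: sum.reindex[OF inj])
qed

text \<open>Blocks of the list of processes are kept as families indexed by list positions, so that one
  statement covers every way of separating the processes into two groups.\<close>

lemma indep_processes_split:
  assumes "indep_processes M Xs" "A \<inter> B = {}" "A \<subseteq> {..<length Xs}" "B \<subseteq> {..<length Xs}"
  defines "T \<equiv> \<lambda>_. \<Pi>\<^sub>M k\<in>(UNIV::int set). (borel::real measure)"
  shows "indep_var (PiM A T) (\<lambda>\<omega>. \<lambda>n\<in>A. \<lambda>k. (Xs ! n) k \<omega>) (PiM B T) (\<lambda>\<omega>. \<lambda>n\<in>B. \<lambda>k. (Xs ! n) k \<omega>)"
  using assms(1) unfolding T_def indep_processes_def by (rule indep_var_restrict) (rule assms)+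

lemma integrable_mult_of_squares:
  fixes f g :: "'a \<Rightarrow> real"
  assumes [measurable]: "f \<in> borel_measurable M" "g \<in> borel_measurable M"
    and "integrable M (\<lambda>x. (f x)\<^sup>2)" "integrable M (\<lambda>x. (g x)\<^sup>2)"
  shows "integrable M (\<lambda>x. f x * g x)"
proof (rule Bochner_Integration.integrable_bound)
  show "integrable M (\<lambda>x. (f x)\<^sup>2 + (g x)\<^sup>2)" using assms by simp
  have "\<bar>a * b\<bar> \<le> \<bar>a\<^sup>2 + b\<^sup>2\<bar>" for a b :: real
  proof -
    have "2 * (\<bar>a\<bar> * \<bar>b\<bar>) \<le> a\<^sup>2 + b\<^sup>2"
      using sum_squares_bound[of "\<bar>a\<bar>" "\<bar>b\<bar>"] by (simp add: mult.assoc)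
    moreover have "0 \<le> \<bar>a\<bar> * \<bar>b\<bar>" by simp
    ultimately show ?thesis unfolding abs_mult by linarith
  qed
  then show "AE x in M. norm (f x * g x) \<le> norm ((f x)\<^sup>2 + (g x)\<^sup>2)" by simp
qed simp

lemma integrable_square_add:
  fixes f g :: "'a \<Rightarrow> real"
  assumes "f \<in> borel_measurable M" "g \<in> borel_measurable M"
    and "integrable M (\<lambda>x. (f x)\<^sup>2)" "integrable M (\<lambda>x. (g x)\<^sup>2)"
  shows "integrable M (\<lambda>x. (f x + g x)\<^sup>2)"
  using integrable_mult_of_squares[OF assms] assms
  by (simp add: power2_sum mult.assoc)

lemma integrable_square_sum:
  fixes f :: "'i \<Rightarrow> 'a \<Rightarrow> real"
  assumes "finite J" "\<And>i. f i \<in> borel_measurable M" "\<And>i. integrable M (\<lambda>x. (f i x)\<^sup>2)"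
  shows "integrable M (\<lambda>x. (\<Sum>i\<in>J. f i x)\<^sup>2)"
  using assms(1)
proof (induction J rule: finite_induct)
  case (insert i J)
  have "(\<lambda>x. \<Sum>i\<in>J. f i x) \<in> borel_measurable M" using assms(2) by measurable
  with insert show ?case by (auto intro!: integrable_square_add assms)
qed simp

end

section \<open>Sequences with geometric autocorrelation\<close>

text \<open>The attacker's sequence. All its second-order properties below follow from the autocorrelation
  alone; Gaussianity enters only in \<open>normal_on_past_combination\<close>.\<close>

locale geometric_correlation = prob_space +
  fixes z :: "int \<Rightarrow> 'a \<Rightarrow> real" and \<rho> S :: real
  assumes z_measurable[measurable]: "\<And>i. z i \<in> borel_measurable M"
    and S_pos: "S > 0" and \<rho>_less: "\<rho> < 1"
    and correlation: "\<And>i j. expectation (\<lambda>\<omega>. z i \<omega> * z (i - int j) \<omega>) = \<rho> ^ j * S"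
begin

text \<open>Integrability comes for free: the integral of a function that is not integrable is 0 by
  convention, while \<open>S\<close> is positive.\<close>

lemma z_square: "integrable M (\<lambda>\<omega>. (z i \<omega>)\<^sup>2)" "expectation (\<lambda>\<omega>. (z i \<omega>)\<^sup>2) = S"
proof -
  show *: "expectation (\<lambda>\<omega>. (z i \<omega>)\<^sup>2) = S"
    using correlation[of i 0] by (simp add: power2_eq_square)
  show "integrable M (\<lambda>\<omega>. (z i \<omega>)\<^sup>2)"
    by (rule ccontr) (use * S_pos in \<open>simp add: not_integrable_integral_eq\<close>)
qed

lemma z_mult_integrable: "integrable M (\<lambda>\<omega>. z i \<omega> * z j \<omega>)"
  by (intro integrable_mult_of_squares z_square(1)) auto

lemma z_integrable: "integrable M (z i)"
  using integrable_mult_of_squares[of "z i" "\<lambda>_. 1"] z_square(1) by simp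

lemma \<rho>_ge: "- 1 \<le> \<rho>"
proof -
  have "0 \<le> expectation (\<lambda>\<omega>. (z 0 \<omega> + z (- 1) \<omega>)\<^sup>2)" by simp
  also have "\<dots> = expectation (\<lambda>\<omega>. (z 0 \<omega>)\<^sup>2 + (z (- 1) \<omega>)\<^sup>2 + 2 * (z 0 \<omega> * z (- 1) \<omega>))"
    by (simp add: power2_sum mult.assoc)
  also have "\<dots> = 2 * S * (1 + \<rho>)"
    using z_square correlation[of 0 1] by (simp add: z_mult_integrable algebra_simps)
  finally show ?thesis using S_pos by (simp add: zero_le_mult_iff)
qed

definition past :: "real \<Rightarrow> nat \<Rightarrow> int \<Rightarrow> 'a \<Rightarrow> real" where
  "past a n l \<omega> = (\<Sum>j<n. a ^ j * z (l - int j) \<omega>)"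

lemma past_measurable[measurable]: "past a n l \<in> borel_measurable M"
  unfolding past_def[abs_def] by measurable

lemma past_square_integrable: "integrable M (\<lambda>\<omega>. (past a n l \<omega>)\<^sup>2)"
  unfolding past_def
  by (intro integrable_square_sum) (auto simp: power_mult_distrib z_square(1))

lemma z_past_integrable: "integrable M (\<lambda>\<omega>. z i \<omega> * past a n l \<omega>)"
  by (intro integrable_mult_of_squares z_square(1) past_square_integrable) auto

lemma correlation_past:
  "expectation (\<lambda>\<omega>. z (l + 1) \<omega> * past a n l \<omega>) = S * \<rho> * (\<Sum>j<n. (a * \<rho>) ^ j)"
proof -
  have "expectation (\<lambda>\<omega>. z (l + 1) \<omega> * past a n l \<omega>)
      = expectation (\<lambda>\<omega>. \<Sum>j<n. a ^ j * (z (l + 1) \<omega> * z ((l + 1) - int (Suc j)) \<omega>))"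
    unfolding past_def sum_distrib_left by (simp add: mult_ac)
  also have "\<dots> = (\<Sum>j<n. a ^ j * (\<rho> ^ Suc j * S))"
    by (subst Bochner_Integration.integral_sum) (simp_all only: z_mult_integrable integrable_mult_right correlation integral_mult_right_zero)
  also have "\<dots> = S * \<rho> * (\<Sum>j<n. (a * \<rho>) ^ j)"
    by (simp add: sum_distrib_left power_mult_distrib mult_ac)
  finally show ?thesis .
qed

lemma past_Suc: "past a (Suc n) l \<omega> = z l \<omega> + a * past a n (l - 1) \<omega>"
  unfolding past_def sum.lessThan_Suc_shift by (simp add: sum_distrib_left algebra_simps)

text \<open>Recursion in the number of terms, from isolating the most recent sample. Its inhomogeneous part is
  the correlation of that sample with the earlier ones.\<close>

lemma second_moment_past_Suc:
  "expectation (\<lambda>\<omega>. (past a (Suc n) l \<omega>)\<^sup>2)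
    = S + 2 * a * (S * \<rho> * (\<Sum>j<n. (a * \<rho>) ^ j)) + a\<^sup>2 * expectation (\<lambda>\<omega>. (past a n (l - 1) \<omega>)\<^sup>2)"
proof -
  have "expectation (\<lambda>\<omega>. (past a (Suc n) l \<omega>)\<^sup>2)
     = expectation (\<lambda>\<omega>. (z l \<omega>)\<^sup>2 + 2 * a * (z l \<omega> * past a n (l - 1) \<omega>) + a\<^sup>2 * (past a n (l - 1) \<omega>)\<^sup>2)"
    unfolding past_Suc by (simp add: power2_sum power_mult_distrib algebra_simps)
  also have "\<dots> = S + 2 * a * (S * \<rho> * (\<Sum>j<n. (a * \<rho>) ^ j)) + a\<^sup>2 * expectation (\<lambda>\<omega>. (past a n (l - 1) \<omega>)\<^sup>2)"
    using correlation_past[of "l - 1" a n] z_square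
    by (simp add: z_past_integrable past_square_integrable)
  finally show ?thesis .
qed

lemma second_moment_past_shift:
  "expectation (\<lambda>\<omega>. (past a n l \<omega>)\<^sup>2) = expectation (\<lambda>\<omega>. (past a n 0 \<omega>)\<^sup>2)"
proof (induction n arbitrary: l)
  case 0 then show ?case by (simp add: past_def)
next
  case (Suc n)
  show ?case unfolding second_moment_past_Suc using Suc[of "l - 1"] Suc[of "0 - 1"] by simp
qed

text \<open>Since \<open>\<rho> < 1\<close>, the geometric sums of correlations stay bounded (also for \<open>\<rho> = - 1\<close>, where they
  oscillate), so the second moment of the sum of \<open>n\<close> samples grows at most linearly. It dominates
  the squared mean of that sum, which grows like \<open>n\<^sup>2 m\<^sup>2\<close>.\<close>

lemma constant_mean_zero:
  assumes "\<And>i. expectation (z i) = m"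
  shows "m = 0"
proof -
  define c where "c = S * (1 + 4 / (1 - \<rho>))"
  have geo: "\<rho> * (\<Sum>j<n. \<rho> ^ j) \<le> 2 / (1 - \<rho>)" for n
  proof -
    have a1: "\<bar>\<rho>\<bar> \<le> 1" using \<rho>_less \<rho>_ge by simp
    have "\<rho> * (1 - \<rho> ^ n) \<le> \<bar>\<rho>\<bar> * \<bar>1 - \<rho> ^ n\<bar>" by (metis abs_ge_self abs_mult)
    also have "\<dots> \<le> 1 * 2"
    proof (rule mult_mono[OF a1])
      have "\<bar>\<rho> ^ n\<bar> \<le> 1" using a1 by (simp add: power_abs power_le_one)
      then show "\<bar>1 - \<rho> ^ n\<bar> \<le> 2" by simp
    qed auto
    finally have "\<rho> * ((1 - \<rho> ^ n) / (1 - \<rho>)) \<le> 2 / (1 - \<rho>)"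
      using \<rho>_less by (simp add: divide_right_mono)
    then show ?thesis using \<rho>_less by (simp add: sum_gp_strict)
  qed
  have growth: "expectation (\<lambda>\<omega>. (past 1 n 0 \<omega>)\<^sup>2) \<le> real n * c" for n
  proof (induction n)
    case 0 then show ?case by (simp add: past_def)
  next
    case (Suc n)
    have "2 * (S * (\<rho> * (\<Sum>j<n. \<rho> ^ j))) \<le> 2 * (S * (2 / (1 - \<rho>)))"
      using geo[of n] S_pos by (intro mult_left_mono) auto
    moreover have "2 * (S * (2 / (1 - \<rho>))) = c - S" by (simp add: c_def algebra_simps)
    ultimately show ?case
      unfolding second_moment_past_Suc using Suc second_moment_past_shift[of 1 n "- 1"]
      by (simp add: algebra_simps)
  qed
  have "real n * m\<^sup>2 \<le> c" if "n > 0" for n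
  proof -
    have "expectation (past 1 n 0) = real n * m"
      unfolding past_def using assms z_integrable by (subst Bochner_Integration.integral_sum) auto
    moreover have int: "integrable M (past 1 n 0)"
      using integrable_mult_of_squares[of "past 1 n 0" "\<lambda>_. 1"] past_square_integrable by simp
    have "variance (past 1 n 0) = expectation (\<lambda>\<omega>. (past 1 n 0 \<omega>)\<^sup>2) - (expectation (past 1 n 0))\<^sup>2"
      by (rule variance_eq[OF int past_square_integrable])
    moreover have "0 \<le> variance (past 1 n 0)" by simp
    ultimately have "(real n * m)\<^sup>2 \<le> real n * c" using growth[of n] by simp
    then have "real n * (real n * m\<^sup>2) \<le> real n * c" by (simp add: power2_eq_square mult_ac)
    then show ?thesis using that by simp
  qed
  note bound = this
  show ?thesis
  proof (rule ccontr)
    assume "m \<noteq> 0"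
    then have "m\<^sup>2 > 0" by simp
    then obtain n where n: "c < real n * m\<^sup>2" using ex_less_of_nat_mult by blast
    with bound[of "Suc n"] \<open>m\<^sup>2 > 0\<close> show False by (simp add: algebra_simps)
  qed
qed

text \<open>The limit is the fixed point of the recursion \<open>second_moment_past_Suc\<close>.\<close>

lemma second_moment_past_tendsto:
  assumes a: "\<bar>a\<bar> < 1"
  shows "(\<lambda>n. expectation (\<lambda>\<omega>. (past a n l \<omega>)\<^sup>2)) \<longlonglongrightarrow> S * (1 + a * \<rho>) / ((1 - a\<^sup>2) * (1 - a * \<rho>))"
    and "(\<lambda>n. S * \<rho> * (\<Sum>j<n. (a * \<rho>) ^ j)) \<longlonglongrightarrow> S * \<rho> / (1 - a * \<rho>)"
proof -
  have "\<bar>\<rho>\<bar> \<le> 1" using \<rho>_less \<rho>_ge by simp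
  then have "\<bar>a\<bar> * \<bar>\<rho>\<bar> \<le> \<bar>a\<bar> * 1" by (intro mult_left_mono) auto
  with a have ar: "\<bar>a * \<rho>\<bar> < 1" by (simp add: abs_mult)
  then have "(\<lambda>j. (a * \<rho>) ^ j) sums (1 / (1 - a * \<rho>))" by (intro geometric_sums) simp
  then have "(\<lambda>n. \<Sum>j<n. (a * \<rho>) ^ j) \<longlonglongrightarrow> 1 / (1 - a * \<rho>)" by (simp add: sums_def)
  from tendsto_mult[OF tendsto_const this, of "S * \<rho>"]
  show lim: "(\<lambda>n. S * \<rho> * (\<Sum>j<n. (a * \<rho>) ^ j)) \<longlonglongrightarrow> S * \<rho> / (1 - a * \<rho>)" by simp
  have a2: "\<bar>a\<^sup>2\<bar> < 1" using a by (simp add: abs_square_less_1)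
  have "(\<lambda>n. expectation (\<lambda>\<omega>. (past a n l \<omega>)\<^sup>2)) \<longlonglongrightarrow> (S + 2 * a * (S * \<rho> / (1 - a * \<rho>))) / (1 - a\<^sup>2)"
  proof (rule affine_recursion_tendsto[OF _ a2])
    show "expectation (\<lambda>\<omega>. (past a (Suc n) l \<omega>)\<^sup>2) = a\<^sup>2 * expectation (\<lambda>\<omega>. (past a n l \<omega>)\<^sup>2)
       + (S + 2 * a * (S * \<rho> * (\<Sum>j<n. (a * \<rho>) ^ j)))" for n
      unfolding second_moment_past_Suc
      using second_moment_past_shift[of a n "l - 1"] second_moment_past_shift[of a n l] by simp
    show "(\<lambda>n. S + 2 * a * (S * \<rho> * (\<Sum>j<n. (a * \<rho>) ^ j))) \<longlonglongrightarrow> S + 2 * a * (S * \<rho> / (1 - a * \<rho>))"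
      by (intro tendsto_intros lim)
  qed
  moreover have "(S + 2 * a * (S * \<rho> / (1 - a * \<rho>))) / (1 - a\<^sup>2) = S * (1 + a * \<rho>) / ((1 - a\<^sup>2) * (1 - a * \<rho>))"
  proof -
    have "1 - a * \<rho> \<noteq> 0" "1 - a\<^sup>2 \<noteq> 0" using ar a2 by auto
    then show ?thesis by (simp add: field_simps)
  qed
  ultimately show "(\<lambda>n. expectation (\<lambda>\<omega>. (past a n l \<omega>)\<^sup>2)) \<longlonglongrightarrow> S * (1 + a * \<rho>) / ((1 - a\<^sup>2) * (1 - a * \<rho>))"
    by simp
qed

text \<open>Expanding the square leaves the limits of the lemma above. The form of the right-hand side splits
  the combination into its projection on the current sample and a remainder uncorrelated with it.\<close>

lemma prediction_residual_tendsto: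
  assumes a: "\<bar>a\<bar> < 1"
  shows "(\<lambda>n. expectation (\<lambda>\<omega>. (z (l + 1) \<omega> - c * past a n l \<omega>)\<^sup>2)) \<longlonglongrightarrow>
    ((1 - \<rho> * c / (1 - \<rho> * a))\<^sup>2 + (1 - \<rho>\<^sup>2) * c\<^sup>2 / ((1 - a\<^sup>2) * (1 - \<rho> * a)\<^sup>2)) * S"
proof -
  have eq: "expectation (\<lambda>\<omega>. (z (l + 1) \<omega> - c * past a n l \<omega>)\<^sup>2)
     = S - 2 * c * (S * \<rho> * (\<Sum>j<n. (a * \<rho>) ^ j)) + c\<^sup>2 * expectation (\<lambda>\<omega>. (past a n l \<omega>)\<^sup>2)" for n
  proof -
    have "expectation (\<lambda>\<omega>. (z (l + 1) \<omega> - c * past a n l \<omega>)\<^sup>2)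
      = expectation (\<lambda>\<omega>. (z (l + 1) \<omega>)\<^sup>2 - 2 * c * (z (l + 1) \<omega> * past a n l \<omega>) + c\<^sup>2 * (past a n l \<omega>)\<^sup>2)"
      by (simp add: power2_diff power_mult_distrib algebra_simps)
    also have "\<dots> = S - 2 * c * (S * \<rho> * (\<Sum>j<n. (a * \<rho>) ^ j)) + c\<^sup>2 * expectation (\<lambda>\<omega>. (past a n l \<omega>)\<^sup>2)"
      using correlation_past[of l a n] z_square by (simp add: z_past_integrable past_square_integrable)
    finally show ?thesis .
  qed
  have "\<bar>\<rho>\<bar> \<le> 1" using \<rho>_less \<rho>_ge by simp
  then have "\<bar>a\<bar> * \<bar>\<rho>\<bar> \<le> \<bar>a\<bar> * 1" by (intro mult_left_mono) auto
  with a have "\<bar>\<rho> * a\<bar> < 1" by (simp add: abs_mult mult.commute)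
  then have x: "1 - \<rho> * a \<noteq> 0" by auto
  have "\<bar>a\<^sup>2\<bar> < 1" using a by (simp add: abs_square_less_1)
  then have y: "1 - a\<^sup>2 \<noteq> 0" by auto
  have alg: "S - 2 * c * (S * \<rho> / (1 - a * \<rho>)) + c\<^sup>2 * (S * (1 + a * \<rho>) / ((1 - a\<^sup>2) * (1 - a * \<rho>)))
     = ((1 - \<rho> * c / (1 - \<rho> * a))\<^sup>2 + (1 - \<rho>\<^sup>2) * c\<^sup>2 / ((1 - a\<^sup>2) * (1 - \<rho> * a)\<^sup>2)) * S"
  proof -
    define X where "X = 1 - \<rho> * a"
    define Y where "Y = 1 - a\<^sup>2"
    have X: "X \<noteq> 0" and Y: "Y \<noteq> 0" using x y by (auto simp: X_def Y_def)
    have "(1 - \<rho> * c / X)\<^sup>2 + (1 - \<rho>\<^sup>2) * c\<^sup>2 / (Y * X\<^sup>2)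
       = 1 - 2 * c * \<rho> / X + c\<^sup>2 * (\<rho>\<^sup>2 * Y + 1 - \<rho>\<^sup>2) / (Y * X\<^sup>2)"
      using X Y by (simp add: divide_simps power2_eq_square) (simp add: algebra_simps)
    also have "\<rho>\<^sup>2 * Y + 1 - \<rho>\<^sup>2 = X * (1 + a * \<rho>)"
      by (simp add: X_def Y_def power2_eq_square algebra_simps)
    also have "c\<^sup>2 * (X * (1 + a * \<rho>)) / (Y * X\<^sup>2) = c\<^sup>2 * (1 + a * \<rho>) / (Y * X)"
      using X by (simp add: power2_eq_square)
    finally have eq: "(1 - \<rho> * c / X)\<^sup>2 + (1 - \<rho>\<^sup>2) * c\<^sup>2 / (Y * X\<^sup>2)
       = 1 - 2 * c * \<rho> / X + c\<^sup>2 * (1 + a * \<rho>) / (Y * X)" .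
    have X': "1 - a * \<rho> = X" by (simp add: X_def)
    show ?thesis
      unfolding X' unfolding X_def[symmetric] Y_def[symmetric] eq
      using X Y by (simp add: field_simps)
  qed
  have "(\<lambda>n. S - 2 * c * (S * \<rho> * (\<Sum>j<n. (a * \<rho>) ^ j)) + c\<^sup>2 * expectation (\<lambda>\<omega>. (past a n l \<omega>)\<^sup>2))
    \<longlonglongrightarrow> S - 2 * c * (S * \<rho> / (1 - a * \<rho>)) + c\<^sup>2 * (S * (1 + a * \<rho>) / ((1 - a\<^sup>2) * (1 - a * \<rho>)))"
    by (intro tendsto_intros second_moment_past_tendsto a)
  then show ?thesis unfolding eq alg .
qed

text \<open>A Gaussian process may have degenerate combinations, which are almost surely constant; the
  constant is then the mean, that is 0, and the variance parameter is 0.\<close>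

lemma normal_on_past_combination:
  assumes gauss: "gaussian_process M z" and mean: "\<And>i. expectation (z i) = 0"
  shows "normal_on M (space M) (\<lambda>\<omega>. \<Sum>j<n. d j * z (l - int j) \<omega>)
     (expectation (\<lambda>\<omega>. (\<Sum>j<n. d j * z (l - int j) \<omega>)\<^sup>2))"
proof -
  define X where "X = (\<lambda>\<omega>. \<Sum>j<n. d j * z (l - int j) \<omega>)"
  have X[measurable]: "X \<in> borel_measurable M" unfolding X_def by measurable
  have EX: "expectation X = 0"
    unfolding X_def using mean z_integrable by (subst Bochner_Integration.integral_sum) auto
  let ?J = "(\<lambda>j. l - int j) ` {..<n}"
  have inj: "inj_on (\<lambda>j. l - int j) {..<n}" by (simp add: inj_on_def)
  have XJ: "X = (\<lambda>\<omega>. \<Sum>i\<in>?J. d (nat (l - i)) * z i \<omega>)"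
    unfolding X_def by (simp add: sum.reindex[OF inj])
  have "finite ?J" by simp
  then obtain m s where "(s = 0 \<and> (AE \<omega> in M. X \<omega> = m)) \<or>
      (s > 0 \<and> distributed M lborel X (normal_density m s))"
    using gauss unfolding gaussian_process_def XJ by meson
  then have "normal_on M (space M) X (expectation (\<lambda>\<omega>. (X \<omega>)\<^sup>2))"
  proof (elim disjE conjE)
    assume ae: "AE \<omega> in M. X \<omega> = m"
    have "expectation X = expectation (\<lambda>_. m)" by (rule integral_cong_AE) (use ae in auto)
    then have "m = 0" using EX by (simp add: prob_space)
    with ae have ae0: "AE \<omega> in M. X \<omega> = 0" by simp
    have "expectation (\<lambda>\<omega>. (X \<omega>)\<^sup>2) = expectation (\<lambda>_. 0)"
      by (rule integral_cong_AE) (use ae0 in auto)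
    moreover have "char (distr M borel X) t = 1" for t
    proof -
      have "char (distr M borel X) t = (\<integral>\<omega>. iexp (t * X \<omega>) \<partial>M)"
        unfolding char_def by (subst integral_distr) auto
      also have "\<dots> = (\<integral>\<omega>. 1 \<partial>M)" by (rule integral_cong_AE) (use ae0 in auto)
      finally show ?thesis by (simp add: prob_space)
    qed
    ultimately show ?thesis by (simp add: normal_on_space_iff_char)
  next
    assume s: "s > 0" and D: "distributed M lborel X (normal_density m s)"
    have "m = 0" using normal_distributed_expectation[OF s D] EX by simp
    with D have D: "distributed M lborel X (normal_density 0 s)" by simp
    have "expectation (\<lambda>\<omega>. (X \<omega>)\<^sup>2) = s\<^sup>2"
      using normal_distributed_variance[OF s D] EX by simp
    then show ?thesis using normal_on_distributed[OF s D] by simp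
  qed
  then show ?thesis by (simp add: X_def)
qed

end

section \<open>Stability of the Kalman and LQG closed loops\<close>

text \<open>Set \<open>c = C\<^sup>2 P + R\<close>. The Riccati equation reads \<open>P = A\<^sup>2 P (R / c) + Q\<close>, so \<open>A\<^sup>2 R / c < 1\<close>, and the
  squared closed-loop coefficient is this number times \<open>R / c \<le> 1\<close>. The last conclusion is the
  Lyapunov equation: \<open>P\<close> is the stationary variance of a recursion with that coefficient and an input of
  variance \<open>Q + (A K)\<^sup>2 R\<close>.\<close>

lemma kalman_closed_loop:
  fixes A C Q R P K :: real
  assumes Q: "Q > 0" and R: "R > 0" and P: "P \<ge> 0"
    and riccati: "P = A\<^sup>2 * P + Q - A\<^sup>2 * C\<^sup>2 * P\<^sup>2 * inverse (C\<^sup>2 * P + R)"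
    and K: "K = C * P / (C\<^sup>2 * P + R)"
  shows "0 < P" "0 < 1 - C * K" "1 - C * K \<le> 1" "\<bar>A * (1 - C * K)\<bar> < 1"
    and "P = (Q + (A * K)\<^sup>2 * R) / (1 - (A * (1 - C * K))\<^sup>2)"
proof -
  define c where "c = C\<^sup>2 * P + R"
  have c: "c > 0" using R P by (simp add: c_def add_nonneg_pos)
  have Kc: "K = C * P / c" by (simp add: K c_def)
  have Rc: "R = c - C\<^sup>2 * P" by (simp add: c_def)
  have CK: "1 - C * K = R / c" using c by (simp add: Kc Rc field_simps power2_eq_square)
  have "R \<le> c" using P by (simp add: c_def)
  then have le: "R / c \<le> 1" using c by simp
  have "A\<^sup>2 * P - A\<^sup>2 * C\<^sup>2 * P\<^sup>2 * inverse c = A\<^sup>2 * P * (R / c)"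
    using c by (simp add: Rc field_simps power2_eq_square)
  then have ric: "P = A\<^sup>2 * P * (R / c) + Q"
    using riccati by (simp add: c_def)
  have "0 \<le> A\<^sup>2 * P * (R / c)" using P R c by simp
  then show Ppos: "0 < P" using ric Q by linarith
  show "0 < 1 - C * K" "1 - C * K \<le> 1" using R c le by (simp_all add: CK)
  have "P * (A\<^sup>2 * (R / c)) < P * 1" using ric Q by (simp add: mult_ac)
  then have "A\<^sup>2 * (R / c) < 1" using Ppos by (simp only: mult_less_cancel_left_pos)
  moreover have "A\<^sup>2 * (R / c) * (R / c) \<le> A\<^sup>2 * (R / c) * 1"
    using le R c by (intro mult_left_mono) auto
  ultimately have sq: "(A * (1 - C * K))\<^sup>2 < 1" by (simp add: CK power2_eq_square mult_ac)
  then show "\<bar>A * (1 - C * K)\<bar> < 1" by (simp add: abs_square_less_1)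
  \<comment> \<open>The noise fed back through the gain restores the factor \<open>(R + C\<^sup>2 P) / c = 1\<close>.\<close>
  have "P * (A * (1 - C * K))\<^sup>2 + (A * K)\<^sup>2 * R = A\<^sup>2 * P * (R / c) * ((R + C\<^sup>2 * P) / c)"
    unfolding CK unfolding Kc using c by (simp add: power2_eq_square field_simps)
  also have "(R + C\<^sup>2 * P) / c = 1" using c by (simp add: Rc)
  finally have "P * (1 - (A * (1 - C * K))\<^sup>2) = Q + (A * K)\<^sup>2 * R"
    using ric by (simp add: algebra_simps)
  then show "P = (Q + (A * K)\<^sup>2 * R) / (1 - (A * (1 - C * K))\<^sup>2)"
    using sq by (simp add: field_simps)
qed

text \<open>Dual to the Kalman filter: the control Riccati equation is the filtering one with \<open>B\<close>, \<open>W\<close>, \<open>U\<close>, \<open>S\<close>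
  in the roles of \<open>C\<close>, \<open>Q\<close>, \<open>R\<close>, \<open>P\<close>.\<close>

lemma lqg_closed_loop:
  fixes A B S W U L :: real
  assumes W: "W > 0" and U: "U > 0" and S: "S \<ge> 0"
    and riccati: "S = A\<^sup>2 * S + W - A\<^sup>2 * B\<^sup>2 * S\<^sup>2 * inverse (B\<^sup>2 * S + U)"
    and L: "L = - (A * B * S) / (B\<^sup>2 * S + U)"
  shows "\<bar>A + B * L\<bar> < 1"
proof -
  have "A + B * L = A * (1 - B * (B * S / (B\<^sup>2 * S + U)))"
    by (simp add: L algebra_simps)
  then show ?thesis using kalman_closed_loop(4)[OF W U S riccati refl] by simp
qed

section \<open>Steady-state laws without and under attack\<close>

text \<open>The coefficients of a current sample minus a filtered past, written as one backward sum, which is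
  the form in which normality of linear combinations is available.\<close>

lemma sum_case_past:
  fixes x :: "int \<Rightarrow> real"
  shows "(\<Sum>j<Suc n. (case j of 0 \<Rightarrow> 1 | Suc i \<Rightarrow> - (c * a ^ i)) * x (k - int j))
    = x k - c * (\<Sum>j<n. a ^ j * x (k - 1 - int j))"
  unfolding sum.lessThan_Suc_shift
  by (simp add: sum_distrib_left sum_negf algebra_simps)

lemma geometric_square_sum_tendsto:
  fixes a c :: real
  assumes "\<bar>a\<bar> < 1"
  shows "(\<lambda>n. \<Sum>j<n. (c * a ^ j)\<^sup>2) \<longlonglongrightarrow> c\<^sup>2 / (1 - a\<^sup>2)"
proof -
  have "norm (a\<^sup>2) < 1" using assms by (simp add: abs_square_less_1)
  then have "(\<lambda>j. c\<^sup>2 * (a\<^sup>2) ^ j) sums (c\<^sup>2 * (1 / (1 - a\<^sup>2)))"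
    by (intro sums_mult geometric_sums)
  then show ?thesis
    by (simp add: sums_def power_mult_distrib power_mult[symmetric] mult.commute)
qed

lemma measurable_two_coordinates:
  assumes "n \<in> I"
  shows "(\<lambda>f. f n i) \<in> borel_measurable (\<Pi>\<^sub>M n\<in>I. \<Pi>\<^sub>M k\<in>(UNIV::int set). (borel::real measure))"
  using measurable_compose[OF measurable_component_singleton[OF assms]
      measurable_component_singleton[OF UNIV_I[of i]]] .

context prob_space
begin

text \<open>Here \<open>\<epsilon>\<close> is the prediction error. Unrolled \<open>n\<close> steps, \<open>C \<epsilon>\<^sub>k + v\<^sub>k\<close> is a backward sum over \<open>w\<close>, a
  backward sum over \<open>v\<close>, and \<open>C a\<^sup>n \<epsilon>\<^sub>k\<^sub>-\<^sub>n\<close>; the two sums are independent of each other and of \<open>e\<close>.\<close>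

lemma innovation_normal_given_watermark:
  fixes w v e \<epsilon> :: "int \<Rightarrow> 'a \<Rightarrow> real"
  assumes w: "iid_gaussian M w Q" "Q > 0" and v: "iid_gaussian M v R" "R > 0"
    and e: "e i \<in> borel_measurable M"
    and ind: "indep_processes M [w, v, e]"
    and \<epsilon>[measurable]: "\<And>i. \<epsilon> i \<in> borel_measurable M"
    and law: "\<And>i. distr M borel (\<epsilon> i) = distr M borel (\<epsilon> 0)"
    and rec: "\<And>i \<omega>. \<omega> \<in> space M \<Longrightarrow> \<epsilon> (i + 1) \<omega> = a * \<epsilon> i \<omega> + (w i \<omega> - b * v i \<omega>)"
    and a: "\<bar>a\<bar> < 1" and B: "B \<in> sets borel"
  shows "normal_on M (e i -` B \<inter> space M) (\<lambda>\<omega>. C * \<epsilon> k \<omega> + v k \<omega>)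
    (R + C\<^sup>2 * ((Q + b\<^sup>2 * R) / (1 - a\<^sup>2)))"
proof -
  have [measurable]: "w j \<in> borel_measurable M" "v j \<in> borel_measurable M" for j
    using iid_gaussianD(2) w(1) v(1) by auto
  define D where "D = e i -` B \<inter> space M"
  have D: "D \<in> events" unfolding D_def using e B by (rule measurable_sets)
  define dw where "dw j = C * a ^ j" for j :: nat
  define dv where "dv j = (case j of 0 \<Rightarrow> 1 | Suc i \<Rightarrow> - (C * b * a ^ i))" for j :: nat
  define Xw where "Xw n \<omega> = (\<Sum>j<n. dw j * w (k - 1 - int j) \<omega>)" for n \<omega>
  define Xv where "Xv n \<omega> = (\<Sum>j<Suc n. dv j * v (k - int j) \<omega>)" for n \<omega>
  let ?sw = "\<lambda>n. Q * (\<Sum>j<n. (dw j)\<^sup>2)" and ?sv = "\<lambda>n. R * (\<Sum>j<Suc n. (dv j)\<^sup>2)"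
  let ?T = "\<lambda>_::nat. \<Pi>\<^sub>M k\<in>(UNIV::int set). (borel::real measure)"
  have Nw: "normal_on M (space M) (Xw n) (?sw n)" for n
    using normal_on_iid_past[OF w, where l="k - 1" and i=k and B=UNIV and d=dw and n=n] by (simp add: Xw_def[abs_def])
  have Nv: "normal_on M (space M) (Xv n) (?sv n)" for n
    using normal_on_iid_past[OF v, where l=k and i="k + 1" and B=UNIV and d=dv and n="Suc n"] by (simp only: Xv_def[abs_def]) simp
  have Be: "{f \<in> space (PiM I ?T). f 2 i \<in> B} \<in> sets (PiM I ?T)" if "2 \<in> I" for I
    using measurable_sets[OF measurable_two_coordinates[OF that] B] by (simp add: vimage_def Int_def conj_commute)
  \<comment> \<open>Adding 0 turns the law of \<open>Xv n\<close> into its law restricted to \<open>D\<close>, by independence of \<open>v\<close> and \<open>e\<close>.\<close>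
  have vD: "normal_on M D (\<lambda>\<omega>. Xv n \<omega> + 0) (?sv n + 0)" for n
  proof (rule normal_on_add[OF Nv normal_on_zero[OF D] indep_processes_split[OF ind, of "{1}" "{2}"]])
    show "(\<lambda>f. \<Sum>j<Suc n. dv j * f 1 (k - int j)) \<in> borel_measurable (PiM {1} ?T)"
      by (intro borel_measurable_sum borel_measurable_times measurable_two_coordinates) simp_all
    show "{f \<in> space (PiM {2} ?T). f 2 i \<in> B} \<in> sets (PiM {2} ?T)" by (rule Be) simp
  qed (auto simp: Xv_def D_def space_PiM)
  have wvD: "normal_on M D (\<lambda>\<omega>. Xw n \<omega> + Xv n \<omega>) (?sw n + ?sv n)" for n
  proof (rule normal_on_add[OF Nw _ indep_processes_split[OF ind, of "{0}" "{1, 2}"]])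
    show "normal_on M D (Xv n) (?sv n)" using vD[of n] by simp
    show "(\<lambda>f. \<Sum>j<n. dw j * f 0 (k - 1 - int j)) \<in> borel_measurable (PiM {0} ?T)"
      by (intro borel_measurable_sum borel_measurable_times measurable_two_coordinates) simp_all
    show "(\<lambda>f. \<Sum>j<Suc n. dv j * f 1 (k - int j)) \<in> borel_measurable (PiM {1, 2} ?T)"
      by (intro borel_measurable_sum borel_measurable_times measurable_two_coordinates) simp_all
    show "{f \<in> space (PiM {1, 2} ?T). f 2 i \<in> B} \<in> sets (PiM {1, 2} ?T)" by (rule Be) simp
  qed (auto simp: Xw_def Xv_def D_def space_PiM)
  have sw: "?sw \<longlonglongrightarrow> Q * (C\<^sup>2 / (1 - a\<^sup>2))"
    unfolding dw_def by (intro tendsto_intros geometric_square_sum_tendsto a)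
  have sv_eq: "?sv n = R * (1 + (\<Sum>j<n. ((C * b) * a ^ j)\<^sup>2))" for n
    unfolding dv_def sum.lessThan_Suc_shift by simp
  have sv: "?sv \<longlonglongrightarrow> R * (1 + (C * b)\<^sup>2 / (1 - a\<^sup>2))"
    unfolding sv_eq by (intro tendsto_intros geometric_square_sum_tendsto a)
  have "normal_on M D (\<lambda>\<omega>. C * \<epsilon> k \<omega> + v k \<omega>) (Q * (C\<^sup>2 / (1 - a\<^sup>2)) + R * (1 + (C * b)\<^sup>2 / (1 - a\<^sup>2)))"
  proof (rule normal_on_limit[OF D wvD _ tendsto_add[OF sw sv]])
    have "(\<lambda>n. - C * a ^ n) \<longlonglongrightarrow> 0"
      using a by (intro tendsto_mult_right_zero LIMSEQ_power_zero) simp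
    from rescaled_stationary_tendsto_zero[of \<epsilon>, OF \<epsilon> law this, of "\<lambda>n. k - int n"]
    have "(\<lambda>n. expectation (\<lambda>\<omega>. min 1 \<bar>- C * a ^ n * \<epsilon> (k - int n) \<omega>\<bar>)) \<longlonglongrightarrow> 0" .
    moreover have "Xw n \<omega> + Xv n \<omega> - (C * \<epsilon> k \<omega> + v k \<omega>) = - C * a ^ n * \<epsilon> (k - int n) \<omega>"
      if "\<omega> \<in> space M" for n \<omega>
    proof -
      have "\<epsilon> k \<omega> = (\<Sum>j<n. a ^ j * (w (k - 1 - int j) \<omega> - b * v (k - 1 - int j) \<omega>)) + a ^ n * \<epsilon> (k - int n) \<omega>"
        by (rule linear_recursion_backward[of "\<lambda>i. \<epsilon> i \<omega>"]) (rule rec[OF that])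
      then have \<epsilon>k: "\<epsilon> k \<omega> = (\<Sum>j<n. a ^ j * w (k - 1 - int j) \<omega>)
          - b * (\<Sum>j<n. a ^ j * v (k - 1 - int j) \<omega>) + a ^ n * \<epsilon> (k - int n) \<omega>"
        by (simp add: right_diff_distrib sum_subtractf sum_distrib_left mult.left_commute)
      have Xw: "Xw n \<omega> = C * (\<Sum>j<n. a ^ j * w (k - 1 - int j) \<omega>)"
        by (simp add: Xw_def dw_def sum_distrib_left mult.assoc)
      have Xv: "Xv n \<omega> = v k \<omega> - C * b * (\<Sum>j<n. a ^ j * v (k - 1 - int j) \<omega>)"
        unfolding Xv_def dv_def by (rule sum_case_past[of _ _ "\<lambda>i. v i \<omega>"])
      show ?thesis unfolding \<epsilon>k Xw Xv by (simp add: algebra_simps)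
    qed
    ultimately show "(\<lambda>n. expectation (\<lambda>\<omega>. min 1 \<bar>Xw n \<omega> + Xv n \<omega> - (C * \<epsilon> k \<omega> + v k \<omega>)\<bar>)) \<longlonglongrightarrow> 0"
      by (simp cong: Bochner_Integration.integral_cong)
  qed measurable
  also have "Q * (C\<^sup>2 / (1 - a\<^sup>2)) + R * (1 + (C * b)\<^sup>2 / (1 - a\<^sup>2))
      = R + C\<^sup>2 * ((Q + b\<^sup>2 * R) / (1 - a\<^sup>2))"
    by (simp add: add_divide_distrib algebra_simps power_mult_distrib)
  finally show ?thesis unfolding D_def .
qed

end

context geometric_correlation
begin

text \<open>Here \<open>X\<close> is the prediction that the controller computes from \<open>z\<close>. Its dependence on the last
  watermark sample is \<open>b e\<^sub>k\<^sub>-\<^sub>1\<close>, which the added term cancels; what remains is a combination of \<open>z\<close> and of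
  \<open>e\<^sub>j\<close> with \<open>j \<le> k - 2\<close>, and both are independent of \<open>e\<^sub>k\<^sub>-\<^sub>1\<close>.\<close>

lemma attacked_residual_normal_given_watermark:
  fixes e X :: "int \<Rightarrow> 'a \<Rightarrow> real"
  assumes gauss: "gaussian_process M z" and mean: "\<And>i. expectation (z i) = 0"
    and e: "iid_gaussian M e s2" "s2 > 0"
    and ind: "indep_processes M [z, e]"
    and X[measurable]: "\<And>i. X i \<in> borel_measurable M"
    and law: "\<And>i. distr M borel (X i) = distr M borel (X 0)"
    and rec: "\<And>i \<omega>. \<omega> \<in> space M \<Longrightarrow> X (i + 1) \<omega> = a * X i \<omega> + (g * z i \<omega> + b * e i \<omega>)"
    and a: "\<bar>a\<bar> < 1" and B: "B \<in> sets borel"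
  shows "normal_on M (e (k - 1) -` B \<inter> space M) (\<lambda>\<omega>. z k \<omega> - C * X k \<omega> + C * b * e (k - 1) \<omega>)
    (((1 - \<rho> * (C * g) / (1 - \<rho> * a))\<^sup>2
        + (1 - \<rho>\<^sup>2) * (C * g)\<^sup>2 / ((1 - a\<^sup>2) * (1 - \<rho> * a)\<^sup>2)) * S
      + s2 * ((C * b * a)\<^sup>2 / (1 - a\<^sup>2)))"
proof -
  have [measurable]: "e j \<in> borel_measurable M" for j
    using iid_gaussianD(2) e(1) by auto
  define D where "D = e (k - 1) -` B \<inter> space M"
  have D: "D \<in> events" unfolding D_def by (rule measurable_sets[OF _ B]) simp
  define dz where "dz j = (case j of 0 \<Rightarrow> 1 | Suc i \<Rightarrow> - (C * g * a ^ i))" for j :: nat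
  define de where "de j = - (C * b * a) * a ^ j" for j :: nat
  \<comment> \<open>One step more is unrolled for \<open>z\<close> than for \<open>e\<close>: the cancelled sample \<open>e\<^sub>k\<^sub>-\<^sub>1\<close> accounts for the first step.\<close>
  define Xz where "Xz n \<omega> = (\<Sum>j<Suc (Suc n). dz j * z (k - int j) \<omega>)" for n \<omega>
  define Xe where "Xe n \<omega> = (\<Sum>j<n. de j * e (k - 2 - int j) \<omega>)" for n \<omega>
  let ?sz = "\<lambda>n. expectation (\<lambda>\<omega>. (Xz n \<omega>)\<^sup>2)" and ?se = "\<lambda>n. s2 * (\<Sum>j<n. (de j)\<^sup>2)"
  let ?T = "\<lambda>_::nat. \<Pi>\<^sub>M k\<in>(UNIV::int set). (borel::real measure)"
  have Xz_past: "Xz n \<omega> = z k \<omega> - C * g * past a (Suc n) (k - 1) \<omega>" for n \<omega>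
    unfolding Xz_def dz_def past_def by (rule sum_case_past[of _ _ "\<lambda>i. z i \<omega>"])
  have Nz: "normal_on M (space M) (Xz n) (?sz n)" for n
    unfolding Xz_def by (rule normal_on_past_combination[OF gauss mean])
  have Ne: "normal_on M D (Xe n) (?se n)" for n
    using normal_on_iid_past[OF e, where l="k - 2" and i="k - 1" and B=B and d=de and n=n] B by (simp add: Xe_def[abs_def] D_def)
  have Nze: "normal_on M D (\<lambda>\<omega>. Xz n \<omega> + Xe n \<omega>) (?sz n + ?se n)" for n
  proof (rule normal_on_add[OF Nz Ne indep_processes_split[OF ind, of "{0}" "{1}"]])
    show "(\<lambda>f. \<Sum>j<Suc (Suc n). dz j * f 0 (k - int j)) \<in> borel_measurable (PiM {0} ?T)"
      by (intro borel_measurable_sum borel_measurable_times measurable_two_coordinates) simp_all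
    show "(\<lambda>f. \<Sum>j<n. de j * f 1 (k - 2 - int j)) \<in> borel_measurable (PiM {1} ?T)"
      by (intro borel_measurable_sum borel_measurable_times measurable_two_coordinates) simp_all
    show "{f \<in> space (PiM {1} ?T). f 1 (k - 1) \<in> B} \<in> sets (PiM {1} ?T)"
      using measurable_sets[OF measurable_two_coordinates[of 1 "{1}" "k - 1"] B]
      by (simp add: vimage_def Int_def conj_commute del: One_nat_def)
  qed (auto simp: Xz_def Xe_def D_def space_PiM)
  have sz: "?sz \<longlonglongrightarrow> ((1 - \<rho> * (C * g) / (1 - \<rho> * a))\<^sup>2
        + (1 - \<rho>\<^sup>2) * (C * g)\<^sup>2 / ((1 - a\<^sup>2) * (1 - \<rho> * a)\<^sup>2)) * S"
    using LIMSEQ_Suc[OF prediction_residual_tendsto[OF a, of "k - 1" "C * g"]]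
    unfolding Xz_past by simp
  have se: "?se \<longlonglongrightarrow> s2 * ((- (C * b * a))\<^sup>2 / (1 - a\<^sup>2))"
    unfolding de_def by (intro tendsto_intros geometric_square_sum_tendsto a)
  have "normal_on M D (\<lambda>\<omega>. z k \<omega> - C * X k \<omega> + C * b * e (k - 1) \<omega>)
    (((1 - \<rho> * (C * g) / (1 - \<rho> * a))\<^sup>2
        + (1 - \<rho>\<^sup>2) * (C * g)\<^sup>2 / ((1 - a\<^sup>2) * (1 - \<rho> * a)\<^sup>2)) * S + s2 * ((- (C * b * a))\<^sup>2 / (1 - a\<^sup>2)))"
  proof (rule normal_on_limit[OF D Nze _ tendsto_add[OF sz se]])
    have "(\<lambda>n. C * a ^ Suc n) \<longlonglongrightarrow> 0"
      using LIMSEQ_Suc[OF LIMSEQ_power_zero[of a]] a by (intro tendsto_mult_right_zero) simp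
    from rescaled_stationary_tendsto_zero[of X, OF X law this, of "\<lambda>n. k - int (Suc n)"]
    have "(\<lambda>n. expectation (\<lambda>\<omega>. min 1 \<bar>C * a ^ Suc n * X (k - int (Suc n)) \<omega>\<bar>)) \<longlonglongrightarrow> 0" .
    moreover have "Xz n \<omega> + Xe n \<omega> - (z k \<omega> - C * X k \<omega> + C * b * e (k - 1) \<omega>)
        = C * a ^ Suc n * X (k - int (Suc n)) \<omega>"
      if "\<omega> \<in> space M" for n \<omega>
    proof -
      have "X k \<omega> = (\<Sum>j<Suc n. a ^ j * (g * z (k - 1 - int j) \<omega> + b * e (k - 1 - int j) \<omega>))
          + a ^ Suc n * X (k - int (Suc n)) \<omega>"
        by (rule linear_recursion_backward[of "\<lambda>i. X i \<omega>"]) (rule rec[OF that])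
      also have "(\<Sum>j<Suc n. a ^ j * (g * z (k - 1 - int j) \<omega> + b * e (k - 1 - int j) \<omega>))
          = g * past a (Suc n) (k - 1) \<omega> + b * (\<Sum>j<Suc n. a ^ j * e (k - 1 - int j) \<omega>)"
        unfolding past_def sum_distrib_left sum.distrib[symmetric]
        by (rule sum.cong) (simp_all add: algebra_simps)
      also have "(\<Sum>j<Suc n. a ^ j * e (k - 1 - int j) \<omega>)
          = e (k - 1) \<omega> + a * (\<Sum>j<n. a ^ j * e (k - 2 - int j) \<omega>)"
        unfolding sum.lessThan_Suc_shift by (simp add: sum_distrib_left algebra_simps)
      finally have Xk: "X k \<omega> = g * past a (Suc n) (k - 1) \<omega>
          + b * (e (k - 1) \<omega> + a * (\<Sum>j<n. a ^ j * e (k - 2 - int j) \<omega>)) + a ^ Suc n * X (k - int (Suc n)) \<omega>" .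
      have "Xe n \<omega> = - (C * b * a) * (\<Sum>j<n. a ^ j * e (k - 2 - int j) \<omega>)"
        unfolding Xe_def de_def sum_distrib_left by (simp add: mult.assoc)
      then show ?thesis unfolding Xk Xz_past by (simp add: algebra_simps)
    qed
    ultimately show "(\<lambda>n. expectation (\<lambda>\<omega>. min 1 \<bar>Xz n \<omega> + Xe n \<omega>
        - (z k \<omega> - C * X k \<omega> + C * b * e (k - 1) \<omega>)\<bar>)) \<longlonglongrightarrow> 0"
      by (simp cong: Bochner_Integration.integral_cong)
  qed measurable
  then show ?thesis unfolding D_def by simp
qed

text \<open>The second summand may vanish, as it does for \<open>\<rho> = - 1\<close>. The first one never does: it equals
  \<open>((1 - \<rho> (a + c)) / (1 - \<rho> a))\<^sup>2\<close>, and \<open>\<bar>\<rho> (a + c)\<bar> < 1\<close>.\<close>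

lemma prediction_residual_pos:
  assumes a: "\<bar>a\<bar> < 1" and ac: "\<bar>a + c\<bar> < 1"
  shows "0 < ((1 - \<rho> * c / (1 - \<rho> * a))\<^sup>2 + (1 - \<rho>\<^sup>2) * c\<^sup>2 / ((1 - a\<^sup>2) * (1 - \<rho> * a)\<^sup>2)) * S"
proof -
  have \<rho>: "\<bar>\<rho>\<bar> \<le> 1" using \<rho>_less \<rho>_ge by simp
  have lt: "\<rho> * x < 1" if "\<bar>x\<bar> < 1" for x
  proof -
    have "\<bar>\<rho> * x\<bar> \<le> 1 * \<bar>x\<bar>" unfolding abs_mult using \<rho> by (intro mult_right_mono) auto
    then show ?thesis using that by linarith
  qed
  have "1 - \<rho> * c / (1 - \<rho> * a) = (1 - \<rho> * (a + c)) / (1 - \<rho> * a)"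
    using lt[OF a] by (simp add: field_simps)
  then have "0 < (1 - \<rho> * c / (1 - \<rho> * a))\<^sup>2" using lt[OF a] lt[OF ac] by simp
  moreover have "0 \<le> (1 - \<rho>\<^sup>2) * c\<^sup>2 / ((1 - a\<^sup>2) * (1 - \<rho> * a)\<^sup>2)"
    using \<rho> a by (intro divide_nonneg_nonneg mult_nonneg_nonneg) (auto simp: abs_square_le_1 less_imp_le abs_square_less_1)
  ultimately show ?thesis using S_pos by (intro mult_pos_pos add_pos_nonneg)
qed

end

section \<open>The divergence of the false innovation from the true one\<close>

theorem theorem1:
  fixes M :: "'a measure"
    and A B C Q R P S W U K L \<rho> :: real
    and \<sigma>\<^sub>e \<sigma>\<^sub>z \<sigma>\<^sub>\<gamma> \<sigma>\<^sub>F lam \<A> :: real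
    and w v e :: "int \<Rightarrow> 'a \<Rightarrow> real"  \<comment> \<open>process noise, measurement noise, watermark\<close>
    and x y u x_pred x_filt \<gamma> :: "int \<Rightarrow> 'a \<Rightarrow> real"  \<comment> \<open>no attack\<close>
    and z xF_pred xF_filt \<gamma>F :: "int \<Rightarrow> 'a \<Rightarrow> real"  \<comment> \<open>under attack\<close>
    and k :: int
  assumes "prob_space M"
    \<comment> \<open>noises and watermark\<close>
    and "Q > 0" "R > 0" "\<sigma>\<^sub>e > 0"
    and "iid_gaussian M w Q" "iid_gaussian M v R" "iid_gaussian M e (\<sigma>\<^sub>e\<^sup>2)"
    and "indep_processes M [w, v, e]"
    \<comment> \<open>Kalman and LQG gains\<close>
    and "P = A\<^sup>2 * P + Q - A\<^sup>2 * C\<^sup>2 * P\<^sup>2 * inverse (C\<^sup>2 * P + R)"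
    and "K = C * P / (C\<^sup>2 * P + R)"
    and "W > 0" "U > 0" "S \<ge> 0"
    and "S = A\<^sup>2 * S + W - A\<^sup>2 * B\<^sup>2 * S\<^sup>2 * inverse (B\<^sup>2 * S + U)"
    and "L = - (A * B * S) / (B\<^sup>2 * S + U)"
    \<comment> \<open>closed loop without attack, in steady state\<close>
    and "\<And>i \<omega>. \<omega> \<in> space M \<Longrightarrow> x (i + 1) \<omega> = A * x i \<omega> + B * u i \<omega> + w i \<omega>"
    and "\<And>i \<omega>. \<omega> \<in> space M \<Longrightarrow> y i \<omega> = C * x i \<omega> + v i \<omega>"
    and "\<And>i \<omega>. \<omega> \<in> space M \<Longrightarrow> x_pred (i + 1) \<omega> = A * x_filt i \<omega> + B * u i \<omega>"
    and "\<And>i \<omega>. \<omega> \<in> space M \<Longrightarrow> \<gamma> i \<omega> = y i \<omega> - C * x_pred i \<omega>"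
    and "\<And>i \<omega>. \<omega> \<in> space M \<Longrightarrow> x_filt i \<omega> = x_pred i \<omega> + K * \<gamma> i \<omega>"
    and "\<And>i \<omega>. \<omega> \<in> space M \<Longrightarrow> u i \<omega> = L * x_filt i \<omega> + e i \<omega>"
    and "stationary M (borel :: (real \<times> real) measure) (\<lambda>i \<omega>. (x i \<omega>, x_pred i \<omega>))"
    and "\<And>i. prob_space.expectation M (\<lambda>\<omega>. (x i \<omega> - x_pred i \<omega>)\<^sup>2) = P"
    \<comment> \<open>attack sequence\<close>
    and "\<sigma>\<^sub>z > 0" "\<rho> < 1"
    and "stationary M borel z" "gaussian_process M z"
    and "indep_processes M [z, e]"
    and "\<And>i. prob_space.expectation M (\<lambda>\<omega>. (z i \<omega>)\<^sup>2) = \<sigma>\<^sub>z\<^sup>2"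
    and "\<And>i (j::nat). prob_space.expectation M (\<lambda>\<omega>. z i \<omega> * z (i - int j) \<omega>) = \<rho> ^ j * \<sigma>\<^sub>z\<^sup>2"
    \<comment> \<open>controller recursions under attack, in steady state\<close>
    and "\<And>i \<omega>. \<omega> \<in> space M \<Longrightarrow>
           xF_pred i \<omega> = (A + B * L) * xF_filt (i - 1) \<omega> + B * e (i - 1) \<omega>"
    and "\<And>i \<omega>. \<omega> \<in> space M \<Longrightarrow> \<gamma>F i \<omega> = z i \<omega> - C * xF_pred i \<omega>"
    and "\<And>i \<omega>. \<omega> \<in> space M \<Longrightarrow> xF_filt i \<omega> = xF_pred i \<omega> + K * \<gamma>F i \<omega>"
    and "stationary M borel xF_pred"
    \<comment> \<open>abbreviated quantities\<close>
    and "\<sigma>\<^sub>\<gamma> = sqrt (prob_space.variance M (\<gamma> k))"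
    and "\<sigma>\<^sub>F = sqrt (prob_space.variance M (\<gamma>F k))"
    and "lam = - (B * C * \<sigma>\<^sub>e) / \<sigma>\<^sub>F"
    and "\<A> = (1 - C * K) * (A + B * L)"
  shows "KL (distr M borel (\<lambda>\<omega>. (\<gamma>F k \<omega>, e (k - 1) \<omega>)))
            (distr M borel (\<lambda>\<omega>. (\<gamma> k \<omega>, e (k - 1) \<omega>)))
         = 1 / 2 * ln (1 / (1 - lam\<^sup>2))
           + 1 / 2 * (\<sigma>\<^sub>F\<^sup>2 / \<sigma>\<^sub>\<gamma>\<^sup>2 - 1 - ln (\<sigma>\<^sub>F\<^sup>2 / \<sigma>\<^sub>\<gamma>\<^sup>2))
    \<and> \<sigma>\<^sub>\<gamma>\<^sup>2 = C\<^sup>2 * P + R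
    \<and> \<sigma>\<^sub>F\<^sup>2 =
           ((1 - \<rho> * C * K * (A + B * L) / (1 - \<rho> * \<A>))\<^sup>2
            + (1 - \<rho>\<^sup>2) * C\<^sup>2 * K\<^sup>2 * (A + B * L)\<^sup>2 / ((1 - \<A>\<^sup>2) * (1 - \<rho> * \<A>)\<^sup>2)) * \<sigma>\<^sub>z\<^sup>2
           + B\<^sup>2 * C\<^sup>2 / (1 - \<A>\<^sup>2) * \<sigma>\<^sub>e\<^sup>2
    \<and> \<bar>\<A>\<bar> < 1
    \<and> \<bar>lam\<bar> < 1"
proof -
  interpret prob_space M by fact
  define G where "G = A + B * L"
  have "0 \<le> expectation (\<lambda>\<omega>. (x 0 \<omega> - x_pred 0 \<omega>)\<^sup>2)" by simp
  then have P0: "P \<ge> 0" using assms(23)[of 0] by simp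
  note kal = kalman_closed_loop[OF assms(2,3) P0 assms(9,10)]
  have G1: "\<bar>G\<bar> < 1"
    unfolding G_def by (rule lqg_closed_loop[OF assms(11,12,13,14,15)])
  have calA: "\<A> = (1 - C * K) * G" by (simp add: assms(38) G_def)
  have a1: "\<bar>\<A>\<bar> < 1"
  proof -
    have "\<bar>\<A>\<bar> \<le> 1 * \<bar>G\<bar>"
      unfolding calA abs_mult using kal(2,3) by (intro mult_right_mono) auto
    then show ?thesis using G1 by simp
  qed
  have e_meas[measurable]: "e i \<in> borel_measurable M" and v_meas[measurable]: "v i \<in> borel_measurable M" for i
    using iid_gaussianD(2) assms(6,7) by auto
  have e2: "\<sigma>\<^sub>e\<^sup>2 > 0" using assms(4) by simp
  have E: "distributed M lborel (e (k - 1)) (normal_density 0 \<sigma>\<^sub>e)"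
    using iid_gaussianD(3)[OF assms(7)] assms(4) by simp

  define \<epsilon> where "\<epsilon> i \<omega> = x i \<omega> - x_pred i \<omega>" for i \<omega>
  define \<gamma>' where "\<gamma>' \<omega> = C * \<epsilon> k \<omega> + v k \<omega>" for \<omega>
  have pair_meas: "(\<lambda>\<omega>. (x i \<omega>, x_pred i \<omega>)) \<in> borel_measurable M" for i
    using assms(22) by (simp add: stationary_def)
  have diff_meas: "(\<lambda>p::real \<times> real. fst p - snd p) \<in> borel_measurable borel"
    by (intro borel_measurable_continuous_onI continuous_intros)
  have \<epsilon>_meas[measurable]: "\<epsilon> i \<in> borel_measurable M" for i
    using measurable_compose[OF pair_meas diff_meas] by (simp add: \<epsilon>_def[abs_def])
  have \<epsilon>_law: "distr M borel (\<epsilon> i) = distr M borel (\<epsilon> 0)" for i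
  proof -
    have "distr M borel (\<epsilon> i)
        = distr (distr M borel (\<lambda>\<omega>. (x i \<omega>, x_pred i \<omega>))) borel (\<lambda>p. fst p - snd p)" for i
      by (subst distr_distr[OF diff_meas pair_meas]) (simp add: o_def \<epsilon>_def[abs_def])
    then show ?thesis using stationary_marginal[OF assms(22), of i] by simp
  qed
  \<comment> \<open>The input \<open>B u\<^sub>i\<close> is known to the filter and cancels, and with it the watermark.\<close>
  have \<epsilon>_rec: "\<epsilon> (i + 1) \<omega> = A * (1 - C * K) * \<epsilon> i \<omega> + (w i \<omega> - A * K * v i \<omega>)"
    if "\<omega> \<in> space M" for i \<omega>
    unfolding \<epsilon>_def assms(16)[OF that] assms(18)[OF that] assms(20)[OF that] assms(19)[OF that] assms(17)[OF that]
    by (simp add: algebra_simps)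
  have var_\<gamma>: "R + C\<^sup>2 * ((Q + (A * K)\<^sup>2 * R) / (1 - (A * (1 - C * K))\<^sup>2)) = C\<^sup>2 * P + R"
    using kal(5) by simp
  have N\<gamma>: "normal_on M (e (k - 1) -` Y \<inter> space M) \<gamma>' (C\<^sup>2 * P + R)" if "Y \<in> sets borel" for Y
    unfolding \<gamma>'_def var_\<gamma>[symmetric]
    by (rule innovation_normal_given_watermark[OF assms(5,2,6,3) e_meas assms(8) \<epsilon>_meas \<epsilon>_law \<epsilon>_rec kal(4) that])
  have g2: "C\<^sup>2 * P + R > 0" using P0 assms(3) by (simp add: add_nonneg_pos)
  have \<gamma>_eq: "\<gamma> k \<omega> = \<gamma>' \<omega>" if "\<omega> \<in> space M" for \<omega>
    using assms(17,19)[OF that] by (simp add: \<gamma>'_def \<epsilon>_def algebra_simps)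
  have N\<gamma>s: "normal_on M (space M) \<gamma>' (C\<^sup>2 * P + R)" using N\<gamma>[of UNIV] by simp
  note D\<gamma> = distributed_normal_on[OF N\<gamma>s g2]
  have "variance (\<gamma> k) = variance \<gamma>'"
    using \<gamma>_eq by (simp cong: Bochner_Integration.integral_cong)
  then have \<sigma>\<gamma>: "\<sigma>\<^sub>\<gamma> = sqrt (C\<^sup>2 * P + R)"
    using normal_distributed_variance[OF _ D\<gamma>] g2 by (simp add: assms(35))

  interpret geometric_correlation M z \<rho> "\<sigma>\<^sub>z\<^sup>2"
    using assms(24,25,26,30) by unfold_locales (auto simp: stationary_def)
  \<comment> \<open>Stationarity makes the mean constant, and the autocorrelation then forces it to vanish.\<close>
  have z_mean: "expectation (z i) = 0" for i
  proof -
    have "expectation (z i) = (\<integral>y. y \<partial>distr M borel (z i))" for i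
      by (subst integral_distr) auto
    then have "expectation (z i) = expectation (z 0)" for i
      using stationary_marginal[OF assms(26), of i] by simp
    from constant_mean_zero[OF this] this[of i] show ?thesis by simp
  qed
  \<comment> \<open>The false innovation with its watermark component \<open>- B C e\<^sub>k\<^sub>-\<^sub>1\<close> removed.\<close>
  define V where "V \<omega> = z k \<omega> - C * xF_pred k \<omega> + C * B * e (k - 1) \<omega>" for \<omega>
  \<comment> \<open>The variance of \<open>V\<close> is \<open>\<tau>\<close>, of which \<open>q\<close> comes from \<open>z\<close> and the rest from older watermark samples.\<close>
  define q where "q = ((1 - \<rho> * (C * (G * K)) / (1 - \<rho> * \<A>))\<^sup>2
      + (1 - \<rho>\<^sup>2) * (C * (G * K))\<^sup>2 / ((1 - \<A>\<^sup>2) * (1 - \<rho> * \<A>)\<^sup>2)) * \<sigma>\<^sub>z\<^sup>2"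
  define \<tau> where "\<tau> = q + \<sigma>\<^sub>e\<^sup>2 * ((C * B * \<A>)\<^sup>2 / (1 - \<A>\<^sup>2))"
  have xF_meas: "xF_pred i \<in> borel_measurable M" for i
    using assms(34) by (simp add: stationary_def)
  have xF_rec: "xF_pred (i + 1) \<omega> = \<A> * xF_pred i \<omega> + (G * K * z i \<omega> + B * e i \<omega>)"
    if "\<omega> \<in> space M" for i \<omega>
    unfolding assms(31)[OF that, of "i + 1"]
    by (simp add: calA G_def assms(32,33)[OF that] algebra_simps)
  have NV: "normal_on M (e (k - 1) -` Y \<inter> space M) V \<tau>" if "Y \<in> sets borel" for Y
    unfolding V_def \<tau>_def q_def
    by (rule attacked_residual_normal_given_watermark[OF assms(27) z_mean assms(7) e2 assms(28)
          xF_meas stationary_marginal[OF assms(34)] xF_rec a1 that])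
  \<comment> \<open>Removing the filter correction from the loop leaves the control loop alone.\<close>
  have "\<A> + C * (G * K) = G" by (simp add: calA algebra_simps)
  then have q: "q > 0" unfolding q_def using prediction_residual_pos[OF a1, of "C * (G * K)"] G1 by simp
  have a2: "\<A>\<^sup>2 < 1" using a1 by (simp add: abs_square_less_1)
  have \<tau>: "\<tau> > 0" using q a2 by (simp add: \<tau>_def add_pos_nonneg)
  note indV = indep_var_normal_on[OF NV \<tau> e_meas]
  have NVs: "normal_on M (space M) V \<tau>" using NV[of UNIV] by simp
  note DV = distributed_normal_on[OF NVs \<tau>]
  have "normal_on M (space M) (\<lambda>\<omega>. - (B * C) * e (k - 1) \<omega>) ((- (B * C))\<^sup>2 * \<sigma>\<^sub>e\<^sup>2)"
    by (intro normal_on_scale normal_on_distributed assms(4) E)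
  from normal_on_add[OF NVs this indV, of "\<lambda>x. x" "\<lambda>x. - (B * C) * x" UNIV]
  have NF: "normal_on M (space M) (\<lambda>\<omega>. V \<omega> + - (B * C) * e (k - 1) \<omega>) (\<tau> + (B * C)\<^sup>2 * \<sigma>\<^sub>e\<^sup>2)"
    by simp
  have h2: "\<tau> + (B * C)\<^sup>2 * \<sigma>\<^sub>e\<^sup>2 > 0" using \<tau> by (simp add: add_pos_nonneg)
  note DF = distributed_normal_on[OF NF h2]
  have \<gamma>F_eq: "\<gamma>F k \<omega> = V \<omega> + - (B * C) * e (k - 1) \<omega>" if "\<omega> \<in> space M" for \<omega>
    using assms(32)[OF that] by (simp add: V_def algebra_simps)
  have "variance (\<gamma>F k) = variance (\<lambda>\<omega>. V \<omega> + - (B * C) * e (k - 1) \<omega>)"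
    using \<gamma>F_eq by (simp cong: Bochner_Integration.integral_cong)
  then have \<sigma>F: "\<sigma>\<^sub>F = sqrt (\<tau> + (B * C)\<^sup>2 * \<sigma>\<^sub>e\<^sup>2)"
    using normal_distributed_variance[OF _ DF] h2 by (simp add: assms(36))
  have \<sigma>\<gamma>2: "\<sigma>\<^sub>\<gamma>\<^sup>2 = C\<^sup>2 * P + R" "\<sigma>\<^sub>\<gamma> > 0" using g2 by (auto simp: \<sigma>\<gamma>)
  have \<sigma>F2: "\<sigma>\<^sub>F\<^sup>2 = \<tau> + (B * C)\<^sup>2 * \<sigma>\<^sub>e\<^sup>2" "\<sigma>\<^sub>F > 0" using h2 by (auto simp: \<sigma>F)

  \<comment> \<open>\<open>lam\<close> is the correlation coefficient of the false innovation and the watermark sample.\<close>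
  have lam: "1 - lam\<^sup>2 = \<tau> / \<sigma>\<^sub>F\<^sup>2"
  proof -
    have "lam\<^sup>2 = (B * C)\<^sup>2 * \<sigma>\<^sub>e\<^sup>2 / \<sigma>\<^sub>F\<^sup>2" by (simp add: assms(37) power_divide power_mult_distrib)
    moreover have "\<tau> = \<sigma>\<^sub>F\<^sup>2 - (B * C)\<^sup>2 * \<sigma>\<^sub>e\<^sup>2" using \<sigma>F2(1) by simp
    ultimately show ?thesis using \<sigma>F2(2) by (simp add: diff_divide_distrib)
  qed
  have "1 - lam\<^sup>2 > 0" unfolding lam using \<tau> \<sigma>F2(2) by simp
  then have lam1: "\<bar>lam\<bar> < 1" by (simp add: abs_square_less_1[symmetric])

  have "KL (distr M borel (\<lambda>\<omega>. (\<gamma>F k \<omega>, e (k - 1) \<omega>))) (distr M borel (\<lambda>\<omega>. (\<gamma> k \<omega>, e (k - 1) \<omega>)))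
    = KL (distr M borel (\<lambda>\<omega>. (V \<omega> + - (B * C) * e (k - 1) \<omega>, e (k - 1) \<omega>))) (distr M borel (\<lambda>\<omega>. (\<gamma>' \<omega>, e (k - 1) \<omega>)))"
    by (intro arg_cong2[of _ _ _ _ "KL"] distr_cong refl) (simp_all add: \<gamma>F_eq \<gamma>_eq)
  also have "\<dots> = ln (\<sigma>\<^sub>\<gamma> / sqrt \<tau>) - 1 / 2 + \<sigma>\<^sub>F\<^sup>2 / (2 * \<sigma>\<^sub>\<gamma>\<^sup>2)"
    using \<tau> \<sigma>\<gamma>2(2) \<sigma>F2(2) assms(4)
    by (intro KL_shear_indep_normal[OF _ _ _ _ DV E _ indV])
       (use D\<gamma> DF indep_var_normal_on[OF N\<gamma> g2 e_meas] in \<open>auto simp: \<sigma>\<gamma>[symmetric] \<sigma>F[symmetric]\<close>)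
  also have "ln (\<sigma>\<^sub>\<gamma> / sqrt \<tau>) = 1 / 2 * ln (1 / (1 - lam\<^sup>2)) - 1 / 2 * ln (\<sigma>\<^sub>F\<^sup>2 / \<sigma>\<^sub>\<gamma>\<^sup>2)"
    unfolding lam using \<tau> \<sigma>\<gamma>2(2) \<sigma>F2(2) by (simp add: ln_div ln_realpow ln_sqrt field_simps)
  finally have KL: "KL (distr M borel (\<lambda>\<omega>. (\<gamma>F k \<omega>, e (k - 1) \<omega>))) (distr M borel (\<lambda>\<omega>. (\<gamma> k \<omega>, e (k - 1) \<omega>)))
     = 1 / 2 * ln (1 / (1 - lam\<^sup>2)) + 1 / 2 * (\<sigma>\<^sub>F\<^sup>2 / \<sigma>\<^sub>\<gamma>\<^sup>2 - 1 - ln (\<sigma>\<^sub>F\<^sup>2 / \<sigma>\<^sub>\<gamma>\<^sup>2))"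
    by (simp add: field_simps)

  \<comment> \<open>The most recent watermark sample is the missing first term of the geometric series.\<close>
  have "\<sigma>\<^sub>e\<^sup>2 * ((C * B * \<A>)\<^sup>2 / (1 - \<A>\<^sup>2)) + (B * C)\<^sup>2 * \<sigma>\<^sub>e\<^sup>2 = B\<^sup>2 * C\<^sup>2 / (1 - \<A>\<^sup>2) * \<sigma>\<^sub>e\<^sup>2"
    using a2 by (simp add: power_mult_distrib field_simps)
  moreover have "q = ((1 - \<rho> * C * K * (A + B * L) / (1 - \<rho> * \<A>))\<^sup>2
            + (1 - \<rho>\<^sup>2) * C\<^sup>2 * K\<^sup>2 * (A + B * L)\<^sup>2 / ((1 - \<A>\<^sup>2) * (1 - \<rho> * \<A>)\<^sup>2)) * \<sigma>\<^sub>z\<^sup>2"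
    unfolding q_def G_def[symmetric] by (simp add: power_mult_distrib mult_ac)
  ultimately have "\<sigma>\<^sub>F\<^sup>2 = ((1 - \<rho> * C * K * (A + B * L) / (1 - \<rho> * \<A>))\<^sup>2
            + (1 - \<rho>\<^sup>2) * C\<^sup>2 * K\<^sup>2 * (A + B * L)\<^sup>2 / ((1 - \<A>\<^sup>2) * (1 - \<rho> * \<A>)\<^sup>2)) * \<sigma>\<^sub>z\<^sup>2
           + B\<^sup>2 * C\<^sup>2 / (1 - \<A>\<^sup>2) * \<sigma>\<^sub>e\<^sup>2"
    using \<sigma>F2(1) unfolding \<tau>_def by linarith
  with KL \<sigma>\<gamma>2(1) a1 lam1 show ?thesis by blast
qed

end
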